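(* Let $k \ge 0$ be an integer and let $S$ be a set of $2k$ points in general position in the plane $\mathbb{R}^2$. If $\mathsf{pm}(S) = C_k$, then either $S$ is in convex position, or $k=3$ and $S$ has the order type of the exceptional six-point configuration $P$.
   Context: General position: no three points of the set lie on a common line. Convex position: every point of the set is a vertex of its convex hull. A perfect matching of $S$ (with $|S|=2k$) means a set of $k$ pairwise non-crossing (disjoint) straight-line segments whose endpoints are points of $S$ such that every point of $S$ is an endpoint of exactly one segment. $\mathsf{pm}(S)$ denotes the number of perfect matchings of $S$ in this sense. $C_k=\frac{1}{k+1}\binom{2k}{k}$ is the $k$th Catalan number. Two finite point sets in general position have the same order type if there is a bijection between them that either preserves the orientation (clockwise/counterclockwise) of all ordered triples of points, or reverses the orientation of all of them. The exceptional configuration $P$ consists of the five vertices of a regular pentagon together with its center. Equivalently, a six-point set in general position has the order type of $P$ if and only if exactly five of its points $A_1,\dots,A_5$ are vertices of its convex hull, and the sixth point $Q$ lies in the interior of the convex hull in such a way that for every $j$ the line through $Q$ and $A_j$ has exactly two of the other four points $A_i$ on each side. *)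

theory Defs
  imports "HOL-Analysis.Analysis"
begin

type_synonym point = "real ^ 2"

definition general_position :: "point set \<Rightarrow> bool" where
  "general_position S \<longleftrightarrow> (\<forall>A. A \<subseteq> S \<and> card A = 3 \<longrightarrow> \<not> collinear A)"

definition convex_position :: "point set \<Rightarrow> bool" where
  "convex_position S \<longleftrightarrow> (\<forall>p\<in>S. p extreme_point_of (convex hull S))"

text \<open>A matching is a set of segments, each segment being a set of points of the plane.
  The point \<open>p\<close> is an endpoint of the segment \<open>s\<close> iff
  \<open>s = closed_segment p q\<close> for some \<open>q\<close>. Disjointness is that of closed segments.\<close>

definition perfect_matching :: "point set \<Rightarrow> point set set \<Rightarrow> bool" where
  "perfect_matching S M \<longleftrightarrow>
     2 * card M = card S \<and>
     (\<forall>s\<in>M. \<exists>a\<in>S. \<exists>b\<in>S. a \<noteq> b \<and> s = closed_segment a b) \<and>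
     (\<forall>s\<in>M. \<forall>t\<in>M. s \<noteq> t \<longrightarrow> s \<inter> t = {}) \<and>
     (\<forall>p\<in>S. \<exists>!s. s \<in> M \<and> (\<exists>q. s = closed_segment p q))"

definition pm :: "point set \<Rightarrow> nat" where
  "pm S = card {M. perfect_matching S M}"

definition catalan :: "nat \<Rightarrow> real" where
  "catalan k = 1 / (real k + 1) * real ((2 * k) choose k)"

text \<open>\<open>1\<close> for a counterclockwise triple, \<open>-1\<close> for a clockwise one,
  \<open>0\<close> for a collinear one (in particular if two of the points coincide).\<close>

definition orientation :: "point \<Rightarrow> point \<Rightarrow> point \<Rightarrow> real" where
  "orientation a b c =
     sgn ((b $ 1 - a $ 1) * (c $ 2 - a $ 2) - (b $ 2 - a $ 2) * (c $ 1 - a $ 1))"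

definition same_order_type :: "point set \<Rightarrow> point set \<Rightarrow> bool" where
  "same_order_type S T \<longleftrightarrow>
     (\<exists>f. bij_betw f S T \<and>
        ((\<forall>a\<in>S. \<forall>b\<in>S. \<forall>c\<in>S. orientation (f a) (f b) (f c) = orientation a b c) \<or>
         (\<forall>a\<in>S. \<forall>b\<in>S. \<forall>c\<in>S. orientation (f a) (f b) (f c) = - orientation a b c)))"

definition pentagon_vertex :: "nat \<Rightarrow> point" where
  "pentagon_vertex j = vector [cos (2 * pi * real j / 5), sin (2 * pi * real j / 5)]"

definition pentagon_with_center :: "point set" where
  "pentagon_with_center = insert 0 (pentagon_vertex ` {..<5})"

end

theory Submission
  imports Defs
begin

text \<open>Match an extremal point \<open>p\<close> with every second of the other points in radial order around
  \<open>p\<close> and match the two sides of the connecting line separately: this gives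
  \<open>pm S \<ge> C\<^sub>k\<close> by the Catalan recurrence. In the case of equality, deleting the endpoints of any
  hull edge leaves a set attaining the bound again, so by induction it is in convex position or is
  the exceptional six-point set. A triangular hull has three pairwise incompatible hull edges,
  hence \<open>3 C\<^sub>k\<^sub>-\<^sub>1 \<le> C\<^sub>k\<close>, which forces \<open>k \<ge> 5\<close>.
  Given two interior points \<open>x\<close>, \<open>y\<close>, the ray from \<open>y\<close> through \<open>x\<close> leaves the hull through an edge
  \<open>u v\<close>, so \<open>x\<close> lies in the triangle \<open>u v y\<close> and stays non-extremal when a hull edge disjoint from
  \<open>u v\<close> is deleted. Counting these exit edges excludes all cases with several
  interior points. With a single interior point the hull has an odd number of vertices; a
  pentagon gives the exceptional set, and for longer polygons one or two hull
  edges can be deleted around a triangle containing the interior point.\<close>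

section \<open>Catalan numbers\<close>

lemma catalan_Suc: "catalan (Suc n) = catalan n * (2 * (2 * real n + 1) / (real n + 2))"
proof -
  have "real ((2 * Suc n) choose Suc n) = fact (2 * Suc n) / (fact (Suc n) * fact (Suc n))"
    by (subst binomial_fact) (simp_all del: fact_Suc)
  also have "\<dots> = real ((2 * n) choose n) * ((2 * real n + 2) * (2 * real n + 1) / (real n + 1)\<^sup>2)"
    by (subst binomial_fact) (simp_all add: field_simps power2_eq_square)
  finally have "catalan (Suc n) = 1 / (real n + 2) *
      (real ((2 * n) choose n) * ((2 * real n + 2) * (2 * real n + 1) / (real n + 1)\<^sup>2))"
    unfolding catalan_def by (simp add: add.commute)
  moreover have "1 / (real n + 2) * (B * ((2 * real n + 2) * (2 * real n + 1) / (real n + 1)\<^sup>2)) =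
      1 / (real n + 1) * B * (2 * (2 * real n + 1) / (real n + 2))" for B
    by (simp add: divide_simps power2_eq_square) (simp add: algebra_simps)
  ultimately show ?thesis
    unfolding catalan_def by simp
qed

lemma catalan_pos: "catalan n > 0"
  by (simp add: catalan_def)

text \<open>Identifies the Catalan numbers, up to sign, a factor 2 and a power of 4, with
  coefficients of the power series of sqrt (1 + x). Their convolution thus becomes an instance of
  the Vandermonde identity.\<close>

lemma half_gchoose_Suc: "((1/2::real) gchoose Suc n) = (-1) ^ n * 2 * catalan n / 4 ^ Suc n"
proof (induction n)
  case 0
  show ?case by (simp add: catalan_def)
next
  case (Suc n)
  have "((1/2::real) gchoose Suc (Suc n)) = (1/2 gchoose Suc n) * (1/2 - real (Suc n)) / real (Suc (Suc n))"
    using gbinomial_mult_1[of "1/2::real" "Suc n"] by (simp add: field_simps)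
  also have "\<dots> = (-1) ^ Suc n * 2 * catalan (Suc n) / 4 ^ Suc (Suc n)"
    unfolding Suc.IH catalan_Suc by (simp add: divide_simps) (simp add: algebra_simps)
  finally show ?case .
qed

text \<open>Compare coefficients in \<open>(sqrt (1 + x))\<^sup>2 = 1 + x\<close>.\<close>
lemma catalan_convolution: "catalan (Suc n) = (\<Sum>i\<le>n. catalan i * catalan (n - i))"
proof -
  let ?g = "\<lambda>k. (1/2::real) gchoose k"
  have "0 = (1::real) gchoose (n + 2)"
    using gbinomial_of_nat_symmetric binomial_eq_0[of 1 "n+2"] binomial_gbinomial[of 1 "n+2", where 'a=real] by simp
  also have "\<dots> = (\<Sum>k=0..n+2. ?g k * ?g (n + 2 - k))"
    using gbinomial_Vandermonde[of "1/2::real" "1/2" "n+2"] by simp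
  \<comment> \<open>The end terms \<open>k = 0\<close> and \<open>k = n + 2\<close> contain the
    factor \<open>?g 0 = 1\<close>. In the others both arguments are successors, as
    \<open>half_gchoose_Suc\<close> requires.\<close>
  also have "\<dots> = 2 * ?g (n + 2) + (\<Sum>i\<le>n. ?g (Suc i) * ?g (Suc (n - i)))"
  proof -
    have "(\<Sum>k\<le>Suc (Suc n). ?g k * ?g (n + 2 - k)) =
        ?g (n + 2) + ((\<Sum>i\<le>n. ?g (Suc i) * ?g (n + 2 - Suc i)) + ?g (n + 2))"
      by (subst sum.atMost_Suc_shift, subst sum.atMost_Suc) simp
    also have "(\<Sum>i\<le>n. ?g (Suc i) * ?g (n + 2 - Suc i)) = (\<Sum>i\<le>n. ?g (Suc i) * ?g (Suc (n - i)))"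
      by (intro sum.cong) (auto simp: Suc_diff_le)
    finally show ?thesis
      by (simp add: atLeast0AtMost)
  qed
  also have "(\<Sum>i\<le>n. ?g (Suc i) * ?g (Suc (n - i))) =
      (\<Sum>i\<le>n. (-1) ^ n * 4 / 4 ^ (n + 2) * (catalan i * catalan (n - i)))"
  proof (rule sum.cong)
    fix i assume "i \<in> {..n}"
    then obtain j where n: "n = i + j" by (auto simp: le_iff_add)
    show "?g (Suc i) * ?g (Suc (n - i)) = (-1) ^ n * 4 / 4 ^ (n + 2) * (catalan i * catalan (n - i))"
      unfolding half_gchoose_Suc n by (simp add: power_add field_simps)
  qed simp
  also have "\<dots> = (-1) ^ n * 4 / 4 ^ (n + 2) * (\<Sum>i\<le>n. catalan i * catalan (n - i))"
    by (simp add: sum_distrib_left)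
  finally show ?thesis
    using half_gchoose_Suc[of "Suc n"] by (simp add: field_simps)
qed

text \<open>The quotient of consecutive Catalan numbers is \<open>2 * (2 * n + 1) / (n + 2)\<close>,
  which is below 3 exactly for \<open>n < 4\<close>. At \<open>k = 5\<close> equality holds: 42 = 3
  * 14.\<close>

lemma catalan_less_triple:
  assumes "2 \<le> k" "k \<le> 4"
  shows "catalan k < 3 * catalan (k - 1)"
proof -
  obtain n where k: "k = Suc n" "1 \<le> n" "n \<le> 3" using assms by (cases k) auto
  have "2 * (2 * real n + 1) / (real n + 2) < 3"
    using k by (simp add: divide_simps)
  then show ?thesis
    unfolding k(1) catalan_Suc using mult_strict_left_mono[OF _ catalan_pos[of n]] by fastforce
qed

section \<open>Orientation predicates\<close>

text \<open>Twice the signed area of the triangle. Keeping the value and not only its sign makes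
  algebraic identities available.\<close>

definition det3 :: "point \<Rightarrow> point \<Rightarrow> point \<Rightarrow> real" where
  "det3 a b c = (b $ 1 - a $ 1) * (c $ 2 - a $ 2) - (b $ 2 - a $ 2) * (c $ 1 - a $ 1)"

definition ccw :: "point \<Rightarrow> point \<Rightarrow> point \<Rightarrow> bool" where
  "ccw a b c \<longleftrightarrow> det3 a b c > 0"

lemma orientation_det3: "orientation a b c = sgn (det3 a b c)"
  by (simp add: orientation_def det3_def)

lemma det3_rotate: "det3 b c a = det3 a b c"
  by (simp add: det3_def algebra_simps)

lemma det3_swap: "det3 a c b = - det3 a b c"
  by (simp add: det3_def algebra_simps)

lemma ccw_rotate: "ccw a b c \<longleftrightarrow> ccw b c a"
  by (simp add: ccw_def det3_rotate)

lemma ccw_asym: "ccw a b c \<Longrightarrow> \<not> ccw a c b"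
  by (simp add: ccw_def det3_swap[of a c b])

lemma ccw_irrefl [simp]: "\<not> ccw a a b" "\<not> ccw a b a" "\<not> ccw b a a"
  by (simp_all add: ccw_def det3_def)

text \<open>Turning around \<open>t\<close> is transitive only inside a half plane, here the one to
  the left of the line from \<open>t\<close> to \<open>s\<close>. The three-term Grassmann-Pluecker
  relation for the four vectors from \<open>t\<close> gives the sign.\<close>

lemma ccw_trans:
  assumes "ccw t s x" "ccw t s b" "ccw t s c" "ccw t x b" "ccw t b c"
  shows "ccw t x c"
proof -
  have "det3 t s b * det3 t x c = det3 t s x * det3 t b c + det3 t s c * det3 t x b"
    by (simp add: det3_def algebra_simps)
  then have "det3 t s b * det3 t x c > 0"
    using assms unfolding ccw_def by (simp add: add_pos_pos)
  then show ?thesis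
    using assms unfolding ccw_def by (simp add: zero_less_mult_iff)
qed

definition in_tri :: "point \<Rightarrow> point \<Rightarrow> point \<Rightarrow> point \<Rightarrow> bool" where
  "in_tri a b c x \<longleftrightarrow> ccw a b x \<and> ccw b c x \<and> ccw c a x"

text \<open>The map from \<open>r\<close> to \<open>det3 x y r\<close> is affine and vanishes at
  \<open>x\<close>. Since \<open>x\<close> is a positive combination of \<open>a\<close>,
  \<open>b\<close>, \<open>c\<close>, weighted by the opposite subtriangles, the three values cannot
  all be positive.\<close>

lemma in_tri_not_one_side:
  assumes "in_tri a b c x" "ccw x y a" "ccw x y b" "ccw x y c"
  shows False
proof -
  have "det3 b c x * det3 x y a + det3 c a x * det3 x y b + det3 a b x * det3 x y c = 0"
    by (simp add: det3_def algebra_simps)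
  moreover have "det3 b c x * det3 x y a > 0" "det3 c a x * det3 x y b > 0" "det3 a b x * det3 x y c > 0"
    using assms by (simp_all add: in_tri_def ccw_def)
  ultimately show False by linarith
qed

lemma in_tri_not_one_side':
  assumes "in_tri a b c x" "ccw y x a" "ccw y x b" "ccw y x c"
  shows False
proof -
  have "det3 b c x * det3 y x a + det3 c a x * det3 y x b + det3 a b x * det3 y x c = 0"
    by (simp add: det3_def algebra_simps)
  moreover have "det3 b c x * det3 y x a > 0" "det3 c a x * det3 y x b > 0" "det3 a b x * det3 y x c > 0"
    using assms by (simp_all add: in_tri_def ccw_def)
  ultimately show False by linarith
qed

lemma collinear_iff_det3: "collinear {a, b, c} \<longleftrightarrow> det3 a b c = 0"
proof (cases "a = c")
  case True
  then show ?thesis by (simp add: det3_def insert_commute)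
next
  case False
  show ?thesis
  proof
    assume "collinear {a, b, c}"
    then obtain u where "b = u *\<^sub>R a + (1 - u) *\<^sub>R c"
      using False by (auto simp: collinear_3_expand)
    then have b: "b $ i = u * a $ i + (1 - u) * c $ i" for i
      by simp
    show "det3 a b c = 0"
      by (simp only: det3_def b[of 1] b[of 2]) (simp add: algebra_simps)
  next
    assume d: "det3 a b c = 0"
    \<comment> \<open>The parameter is read off a coordinate in which \<open>a\<close> and
      \<open>c\<close> differ.\<close>
    have "\<exists>u. b = u *\<^sub>R a + (1 - u) *\<^sub>R c"
    proof (cases "a $ 1 = c $ 1")
      case True
      then have ne: "a $ 2 \<noteq> c $ 2" using False by (simp add: vec_eq_iff forall_2)
      let ?u = "(b $ 2 - c $ 2) / (a $ 2 - c $ 2)"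
      have "b = ?u *\<^sub>R a + (1 - ?u) *\<^sub>R c"
        using d ne True by (simp add: vec_eq_iff forall_2 det3_def divide_simps) (simp add: algebra_simps)
      then show ?thesis by blast
    next
      case ne: False
      let ?u = "(b $ 1 - c $ 1) / (a $ 1 - c $ 1)"
      have "b = ?u *\<^sub>R a + (1 - ?u) *\<^sub>R c"
        using d ne by (simp add: vec_eq_iff forall_2 det3_def divide_simps) (simp add: algebra_simps)
      then show ?thesis by blast
    qed
    then show "collinear {a, b, c}"
      using False by (auto simp: collinear_3_expand)
  qed
qed

lemma general_position_ccw:
  assumes "general_position S" "a \<in> S" "b \<in> S" "c \<in> S" "a \<noteq> b" "b \<noteq> c" "a \<noteq> c"
  shows "ccw a b c \<or> ccw a c b"
proof -
  have "\<not> collinear {a, b, c}"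
    using assms by (auto simp: general_position_def)
  then show ?thesis
    using det3_swap[of a b c] by (auto simp: collinear_iff_det3 ccw_def)
qed

lemma general_position_subset: "general_position S \<Longrightarrow> T \<subseteq> S \<Longrightarrow> general_position T"
  by (auto simp: general_position_def)

section \<open>Extremal points and hull edges\<close>

text \<open>In general position this says that \<open>p\<close> is an extreme point of the convex hull.\<close>
definition extremal :: "point set \<Rightarrow> point \<Rightarrow> bool" where
  "extremal S p \<longleftrightarrow> (\<forall>a\<in>S. \<forall>b\<in>S. \<forall>c\<in>S. \<not> in_tri a b c p)"

lemma in_tri_imp_in_hull:
  assumes "in_tri a b c p"
  shows "p \<in> convex hull {a, b, c}"
proof -
  \<comment> \<open>The three determinants are unnormalised barycentric coordinates of
    \<open>p\<close>.\<close>
  let ?D = "det3 b c p + det3 c a p + det3 a b p"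
  have pos: "det3 b c p > 0" "det3 c a p > 0" "det3 a b p > 0"
    using assms by (auto simp: in_tri_def ccw_def)
  have "?D *\<^sub>R p = det3 b c p *\<^sub>R a + det3 c a p *\<^sub>R b + det3 a b p *\<^sub>R c"
    by (simp add: vec_eq_iff forall_2 det3_def algebra_simps)
  then have "inverse ?D *\<^sub>R ?D *\<^sub>R p =
      inverse ?D *\<^sub>R (det3 b c p *\<^sub>R a + det3 c a p *\<^sub>R b + det3 a b p *\<^sub>R c)"
    by simp
  then have "p = (det3 b c p / ?D) *\<^sub>R a + (det3 c a p / ?D) *\<^sub>R b + (det3 a b p / ?D) *\<^sub>R c"
    using pos by (simp add: scaleR_add_right divide_inverse mult.commute)
  moreover have "det3 b c p / ?D + det3 c a p / ?D + det3 a b p / ?D = 1"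
    using pos by (simp flip: add_divide_distrib)
  ultimately show ?thesis
    unfolding convex_hull_3 using pos
    by (intro CollectI exI[of _ "det3 b c p / ?D"] exI[of _ "det3 c a p / ?D"] exI[of _ "det3 a b p / ?D"]) simp
qed

lemma general_position_not_between:
  assumes "general_position S" "p \<in> S" "a \<in> S" "b \<in> S" "p \<noteq> a" "p \<noteq> b"
  shows "p \<notin> convex hull {a, b}"
proof
  assume "p \<in> convex hull {a, b}"
  then obtain u where u: "p = (1 - u) *\<^sub>R a + u *\<^sub>R b"
    by (auto simp: closed_segment_def simp flip: segment_convex_hull)
  then have "a \<noteq> b" using assms by (auto simp: algebra_simps)
  then have "det3 p a b \<noteq> 0"
    using general_position_ccw[of S p a b] assms det3_swap[of p a b] by (auto simp: ccw_def)
  moreover have "det3 p a b = 0"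
    by (simp add: u det3_def algebra_simps)
  ultimately show False by simp
qed

text \<open>By Caratheodory at most three other points span \<open>p\<close>. Fewer than three, or a
  vanishing coefficient, would put \<open>p\<close> on a segment between points of \<open>S\<close>,
  against general position.\<close>

lemma not_extremal_if_in_hull:
  assumes S: "general_position S" "p \<in> S" and "p \<in> convex hull (S - {p})"
  shows "\<not> extremal S p"
proof -
  obtain T where T: "finite T" "T \<subseteq> S - {p}" "card T \<le> 3" "p \<in> convex hull T"
    using assms(3) unfolding caratheodory[of "S - {p}"] by auto
  have not_small: False if "p \<in> convex hull {a, b}" "a \<in> T" "b \<in> T" for a b
    using general_position_not_between[OF S, of a b] that T by blast
  have "card T \<noteq> 0" using T by auto
  moreover have "card T \<noteq> 1" using T not_small by (auto simp: card_1_singleton_iff)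
  moreover have "card T \<noteq> 2" using T not_small by (auto simp: card_2_iff)
  ultimately have "card T = 3" using T(3) by linarith
  then obtain a b c where abc: "T = {a, b, c}" "a \<noteq> b" "b \<noteq> c" "a \<noteq> c"
    by (auto simp: card_3_iff)
  obtain u v w where uvw: "0 \<le> u" "0 \<le> v" "0 \<le> w" "u + v + w = 1"
      and p: "p = u *\<^sub>R a + v *\<^sub>R b + w *\<^sub>R c"
    using T(4) unfolding abc convex_hull_3 by blast
  have "u \<noteq> 0"
  proof
    assume "u = 0"
    then have "p \<in> convex hull {b, c}" using uvw p by (auto simp: convex_hull_2)
    then show False using not_small abc by blast
  qed
  moreover have "v \<noteq> 0"
  proof
    assume "v = 0"
    then have "p \<in> convex hull {a, c}" using uvw p by (auto simp: convex_hull_2)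
    then show False using not_small abc by blast
  qed
  moreover have "w \<noteq> 0"
  proof
    assume "w = 0"
    then have "p \<in> convex hull {a, b}" using uvw p by (auto simp: convex_hull_2)
    then show False using not_small abc by blast
  qed
  ultimately have pos: "u > 0" "v > 0" "w > 0" using uvw by auto
  have u: "u = 1 - v - w" using uvw by simp
  \<comment> \<open>Both traversals of the triangle are prepared, since \<open>in_tri\<close>
    demands a counterclockwise one.\<close>
  have det: "det3 a b p = w * det3 a b c" "det3 b c p = u * det3 a b c" "det3 c a p = v * det3 a b c"
      "det3 b a p = - w * det3 a b c" "det3 c b p = - u * det3 a b c" "det3 a c p = - v * det3 a b c"
    unfolding p u by (simp_all add: det3_def algebra_simps)
  have "ccw a b c \<or> ccw a c b"
    using general_position_ccw[of S a b c] S abc T by auto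
  then have "in_tri a b c p \<or> in_tri a c b p"
    using pos det det3_swap[of a b c] by (auto simp: in_tri_def ccw_def zero_less_mult_iff mult_less_0_iff)
  then show ?thesis
    using abc T unfolding extremal_def by blast
qed

text \<open>Removing an extreme point from the compact hull leaves a convex set, so no triangle
  spanned by other points can contain it.\<close>

lemma extremal_exists:
  assumes "finite S" "S \<noteq> {}"
  shows "\<exists>p\<in>S. extremal S p"
proof -
  obtain x where x: "x extreme_point_of (convex hull S)"
    using extreme_point_exists_convex[of "convex hull S"] assms
    by (auto simp: compact_convex_hull finite_imp_compact)
  have "x \<in> S" using extreme_point_of_convex_hull x by blast
  moreover have "\<not> in_tri a b c x" if "a \<in> S" "b \<in> S" "c \<in> S" for a b c
  proof
    assume tri: "in_tri a b c x"
    then have "{a, b, c} \<subseteq> convex hull S - {x}"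
      using that by (auto simp: in_tri_def hull_inc)
    moreover have "convex (convex hull S - {x})"
      using x by (simp add: extreme_point_of_stillconvex)
    ultimately have "convex hull {a, b, c} \<subseteq> convex hull S - {x}"
      by (rule hull_minimal)
    then show False using in_tri_imp_in_hull[OF tri] by blast
  qed
  ultimately show ?thesis unfolding extremal_def by blast
qed

lemma convex_position_if_extremal:
  assumes "finite S" "general_position S" "\<And>p. p \<in> S \<Longrightarrow> extremal S p"
  shows "convex_position S"
  unfolding convex_position_def
proof
  fix p assume "p \<in> S"
  then have "p \<notin> convex hull (S - {p})"
    using not_extremal_if_in_hull assms by blast
  then have "p extreme_point_of (convex hull (insert p (S - {p})))"
    using assms by (intro extreme_point_of_convex_hull_insert) auto
  then show "p extreme_point_of (convex hull S)"
    using \<open>p \<in> S\<close> by (simp add: insert_absorb)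
qed

lemma extremal_subset: "extremal S p \<Longrightarrow> T \<subseteq> S \<Longrightarrow> extremal T p"
  unfolding extremal_def by blast

section \<open>Radial order around an extremal point\<close>

definition radially_ordered :: "point set \<Rightarrow> point \<Rightarrow> nat \<Rightarrow> (nat \<Rightarrow> point) \<Rightarrow> bool" where
  "radially_ordered S p n f \<longleftrightarrow>
     bij_betw f {..<n} (S - {p}) \<and> (\<forall>i j. i < j \<longrightarrow> j < n \<longrightarrow> ccw p (f i) (f j))"

text \<open>The other points lie in an open half plane bounded by a line through \<open>p\<close>, so they can be
  ordered by slope.\<close>
lemma radial_order:
  assumes S: "finite S" "general_position S" and p: "p \<in> S" "extremal S p"
  obtains f where "radially_ordered S p (card S - 1) f"
proof -
  have "p \<notin> convex hull (S - {p})"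
    using not_extremal_if_in_hull S p by blast
  then obtain w b where "w \<bullet> p < b" "\<And>x. x \<in> convex hull (S - {p}) \<Longrightarrow> w \<bullet> x > b"
    using separating_hyperplane_closed_point[of "convex hull (S - {p})" p] S
    by (auto simp: finite_imp_compact compact_convex_hull compact_imp_closed)
  then have w: "w \<bullet> (q - p) > 0" if "q \<in> S - {p}" for q
  proof -
    have "q \<in> convex hull (S - {p})" using that by (rule hull_inc)
    then have "b < w \<bullet> q" by (rule \<open>\<And>x. x \<in> convex hull (S - {p}) \<Longrightarrow> w \<bullet> x > b\<close>)
    then show ?thesis using \<open>w \<bullet> p < b\<close> by (simp add: inner_diff_right)
  qed
  \<comment> \<open>The tangent of the signed angle from \<open>w\<close> to \<open>q - p\<close>.
    The separating line makes every denominator positive.\<close>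
  define key where "key q = (w $ 1 * (q - p) $ 2 - w $ 2 * (q - p) $ 1) / (w \<bullet> (q - p))" for q
  have key: "key q < key r \<longleftrightarrow> ccw p q r" if "q \<in> S - {p}" "r \<in> S - {p}" for q r
  proof -
    have ww: "w \<bullet> w > 0" using w[OF that(1)] by auto
    have "key q < key r \<longleftrightarrow> (w $ 1 * (q - p) $ 2 - w $ 2 * (q - p) $ 1) * (w \<bullet> (r - p))
        < (w $ 1 * (r - p) $ 2 - w $ 2 * (r - p) $ 1) * (w \<bullet> (q - p))"
      unfolding key_def using w[OF that(1)] w[OF that(2)] by (simp add: divide_simps mult.commute)
    \<comment> \<open>The difference of the two products is \<open>w \<bullet> w\<close> times the
      determinant, so the choice of \<open>w\<close> does not affect the order.\<close>
    also have "\<dots> \<longleftrightarrow> 0 < (w \<bullet> w) * det3 p q r"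
      by (simp add: inner_vec_def sum_2 det3_def algebra_simps)
    also have "\<dots> \<longleftrightarrow> ccw p q r"
      unfolding ccw_def using ww zero_less_mult_pos mult_pos_pos by blast
    finally show ?thesis .
  qed
  have inj: "inj_on key (S - {p})"
  proof (rule inj_onI, rule ccontr)
    fix q r assume qr: "q \<in> S - {p}" "r \<in> S - {p}" "key q = key r" "q \<noteq> r"
    then have "ccw p q r \<or> ccw p r q"
      using general_position_ccw[of S p q r] S p by auto
    then show False using key qr by (metis less_irrefl)
  qed
  define xs where "xs = sorted_list_of_set (key ` (S - {p}))"
  have fin: "finite (key ` (S - {p}))" using S by simp
  have len: "length xs = card S - 1"
    unfolding xs_def using card_image[OF inj] S p by (simp add: card_Diff_singleton)
  have bij1: "bij_betw (\<lambda>i. xs ! i) {..<card S - 1} (key ` (S - {p}))"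
    using bij_betw_nth[of xs "{..<card S - 1}" "key ` (S - {p})"] len fin
    unfolding xs_def by (simp add: distinct_sorted_list_of_set)
  define f where "f i = inv_into (S - {p}) key (xs ! i)" for i
  have "bij_betw f {..<card S - 1} (S - {p})"
    using bij_betw_trans[OF bij1 bij_betw_inv_into[OF inj_on_imp_bij_betw[OF inj]]]
    by (simp add: f_def comp_def cong: bij_betw_cong)
  moreover have "ccw p (f i) (f j)" if ij: "i < j" "j < card S - 1" for i j
  proof -
    have "xs ! i < xs ! j"
      using ij len strict_sorted_list_of_set[of "key ` (S - {p})"]
      unfolding xs_def[symmetric] by (auto simp: sorted_wrt_iff_nth_less)
    moreover have "xs ! i \<in> key ` (S - {p})" "xs ! j \<in> key ` (S - {p})"
      using bij1 ij by (auto simp: bij_betw_def)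
    ultimately show ?thesis
      using key[of "f i" "f j"] unfolding f_def by (metis f_inv_into_f inv_into_into)
  qed
  ultimately show thesis using that unfolding radially_ordered_def by blast
qed

definition hull_edge :: "point set \<Rightarrow> point \<Rightarrow> point \<Rightarrow> bool" where
  "hull_edge S p q \<longleftrightarrow> p \<in> S \<and> q \<in> S \<and> p \<noteq> q \<and> (\<forall>r\<in>S - {p, q}. ccw p q r)"

text \<open>If the other end of the edge is no corner of an enclosing triangle, all three corners
  lie left of the edge, which is impossible. If it is a corner, the two remaining corners would lie
  on different sides of the line.\<close>

lemma hull_edge_extremal:
  assumes "hull_edge S p q"
  shows "extremal S p" "extremal S q"
proof -
  have side: "ccw p q r" if "r \<in> S" "r \<noteq> p" "r \<noteq> q" for r
    using assms that by (auto simp: hull_edge_def)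
  show "extremal S p"
    unfolding extremal_def
  proof (intro ballI notI)
    fix a b c assume abc: "a \<in> S" "b \<in> S" "c \<in> S" and tri: "in_tri a b c p"
    then have ne: "p \<noteq> a" "p \<noteq> b" "p \<noteq> c" "a \<noteq> b" "b \<noteq> c" "a \<noteq> c"
      by (auto simp: in_tri_def)
    consider "q = a" | "q = b" | "q = c" | "q \<noteq> a" "q \<noteq> b" "q \<noteq> c" by blast
    then show False
    proof cases
      case 4
      then show ?thesis using in_tri_not_one_side[OF tri] side abc ne by blast
    qed (use tri side abc ne ccw_asym ccw_rotate in \<open>unfold in_tri_def, metis\<close>)+
  qed
  show "extremal S q"
    unfolding extremal_def
  proof (intro ballI notI)
    fix a b c assume abc: "a \<in> S" "b \<in> S" "c \<in> S" and tri: "in_tri a b c q"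
    then have ne: "q \<noteq> a" "q \<noteq> b" "q \<noteq> c" "a \<noteq> b" "b \<noteq> c" "a \<noteq> c"
      by (auto simp: in_tri_def)
    consider "p = a" | "p = b" | "p = c" | "p \<noteq> a" "p \<noteq> b" "p \<noteq> c" by blast
    then show False
    proof cases
      case 4
      then show ?thesis using in_tri_not_one_side'[OF tri] side abc ne by blast
    qed (use tri side abc ne ccw_asym ccw_rotate in \<open>unfold in_tri_def, metis\<close>)+
  qed
qed

section \<open>Joining matchings across a line\<close>

abbreviation matchings :: "point set \<Rightarrow> point set set set" where
  "matchings S \<equiv> {M. perfect_matching S M}"

lemma finite_segments: "finite S \<Longrightarrow> finite {closed_segment a b | a b. a \<in> S \<and> b \<in> S}"
  using finite_image_set2[of "\<lambda>a. a \<in> S" "\<lambda>b. b \<in> S" closed_segment] by simp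

lemma perfect_matchingD:
  assumes "perfect_matching S M"
  shows "2 * card M = card S"
    "s \<in> M \<Longrightarrow> \<exists>a\<in>S. \<exists>b\<in>S. a \<noteq> b \<and> s = closed_segment a b"
    "s \<in> M \<Longrightarrow> t \<in> M \<Longrightarrow> s \<noteq> t \<Longrightarrow> s \<inter> t = {}"
    "p \<in> S \<Longrightarrow> \<exists>!s. s \<in> M \<and> (\<exists>q. s = closed_segment p q)"
  using assms unfolding perfect_matching_def by (elim conjE, simp)+

lemma matching_subset_segments:
  "perfect_matching S M \<Longrightarrow> M \<subseteq> {closed_segment a b | a b. a \<in> S \<and> b \<in> S}"
  using perfect_matchingD(2) by blast

lemma finite_matchings: "finite S \<Longrightarrow> finite (matchings S)"
  by (rule finite_subset[OF _ finite_Pow_iff[THEN iffD2, OF finite_segments]])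
    (auto dest: matching_subset_segments)

lemma finite_matching: "finite S \<Longrightarrow> perfect_matching S M \<Longrightarrow> finite M"
  by (rule finite_subset[OF matching_subset_segments finite_segments])

lemma pm_empty [simp]: "pm {} = 1"
proof -
  have "matchings {} = {{}}" by (auto simp: perfect_matching_def)
  then show ?thesis by (simp add: pm_def)
qed

text \<open>Exhibits the left side of a line as an open half space, so that convexity of half spaces
  can be quoted.\<close>

lemma ccw_iff_inner:
  "ccw p q r \<longleftrightarrow> vector [p $ 2 - q $ 2, q $ 1 - p $ 1] \<bullet> r > (vector [p $ 2 - q $ 2, q $ 1 - p $ 1] :: point) \<bullet> p"
proof -
  have "det3 p q r = (vector [p $ 2 - q $ 2, q $ 1 - p $ 1] :: point) \<bullet> r - vector [p $ 2 - q $ 2, q $ 1 - p $ 1] \<bullet> p"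
    by (simp add: det3_def inner_vec_def sum_2 algebra_simps)
  then show ?thesis by (simp add: ccw_def)
qed

lemma convex_ccw: "convex {r. ccw p q r}"
  unfolding ccw_iff_inner by (rule convex_halfspace_gt)

lemma convex_not_ccw: "convex {r. \<not> ccw p q r}"
  unfolding ccw_iff_inner not_less by (rule convex_halfspace_le)

lemma matching_subset_convex:
  assumes "perfect_matching S M" "S \<subseteq> C" "convex C" "s \<in> M"
  shows "s \<subseteq> C" "s \<noteq> {}"
proof -
  obtain a b where "a \<in> S" "b \<in> S" "s = closed_segment a b"
    using perfect_matchingD(2)[OF assms(1,4)] by blast
  then show "s \<subseteq> C" "s \<noteq> {}"
    using closed_segment_subset[of a C b] assms(2,3) by (simp_all add: subsetD)
qed

definition left_of :: "point set \<Rightarrow> point \<Rightarrow> point \<Rightarrow> point set" where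
  "left_of S p q = {r \<in> S. ccw p q r}"

definition matchings_with :: "point set \<Rightarrow> point \<Rightarrow> point \<Rightarrow> point set set set" where
  "matchings_with S p q = {M \<in> matchings S. closed_segment p q \<in> M}"

context
  fixes S :: "point set" and p q :: point
  assumes fin: "finite S" and gp: "general_position S"
    and pq: "p \<in> S" "q \<in> S" "p \<noteq> q"
begin

lemma sides_partition:
  "S = {p, q} \<union> left_of S p q \<union> left_of S q p"
  "left_of S p q \<inter> left_of S q p = {}"
  "p \<notin> left_of S p q" "q \<notin> left_of S p q" "p \<notin> left_of S q p" "q \<notin> left_of S q p"
proof -
  have "ccw p q r \<or> ccw q p r" if "r \<in> S" "r \<noteq> p" "r \<noteq> q" for r
    using general_position_ccw[OF gp pq(1,2) that(1) pq(3)] that(2,3) ccw_rotate[of q p r] by simp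
  then show "S = {p, q} \<union> left_of S p q \<union> left_of S q p"
    using pq unfolding left_of_def by blast
  have "\<not> (ccw p q r \<and> ccw q p r)" for r
    using ccw_asym[of p q r] ccw_rotate[of q p r] by blast
  then show "left_of S p q \<inter> left_of S q p = {}"
    unfolding left_of_def by blast
qed (auto simp: left_of_def)

text \<open>Convexity keeps the segments of \<open>M1\<close> and \<open>M2\<close> in opposite open
  half planes, and the segment from \<open>p\<close> to \<open>q\<close> avoids both. Hence no two
  segments from different parts meet.\<close>

lemma join_matchings:
  assumes M1: "perfect_matching (left_of S p q) M1" and M2: "perfect_matching (left_of S q p) M2"
  shows "insert (closed_segment p q) (M1 \<union> M2) \<in> matchings_with S p q"
proof -
  let ?L = "left_of S p q" and ?R = "left_of S q p" and ?pq = "closed_segment p q"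
  let ?M = "insert ?pq (M1 \<union> M2)"
  have s1: "s \<subseteq> {r. ccw p q r}" "s \<noteq> {}" if "s \<in> M1" for s
    using matching_subset_convex[OF M1 _ convex_ccw that, of p q] by (auto simp: left_of_def)
  have s2: "s \<subseteq> {r. ccw q p r}" "s \<noteq> {}" if "s \<in> M2" for s
    using matching_subset_convex[OF M2 _ convex_ccw that, of q p] by (auto simp: left_of_def)
  have s0: "?pq \<subseteq> {r. \<not> ccw p q r}" "?pq \<subseteq> {r. \<not> ccw q p r}"
    using convex_not_ccw by (intro closed_segment_subset; simp)+
  have lr: "\<not> (ccw p q r \<and> ccw q p r)" for r
    using ccw_asym[of p q r] ccw_rotate[of q p r] by blast
  have d12: "s \<inter> t = {}" if "s \<in> M1" "t \<in> M2" for s t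
    using s1(1)[OF that(1)] s2(1)[OF that(2)] lr by blast
  have d1: "s \<inter> ?pq = {}" if "s \<in> M1" for s
    using s1(1)[OF that(1)] s0 by blast
  have d2: "s \<inter> ?pq = {}" if "s \<in> M2" for s
    using s2(1)[OF that(1)] s0 by blast
  \<comment> \<open>Disjoint segments are distinct because segments are nonempty; the count of
    segments depends on this.\<close>
  have nin: "?pq \<notin> M1" "?pq \<notin> M2" "M1 \<inter> M2 = {}"
    using d1 d2 d12 s1(2) by fastforce+
  have finL: "finite ?L" "finite ?R" using fin by (auto simp: left_of_def)
  have finM: "finite M1" "finite M2"
    using finite_matching[OF finL(1) M1] finite_matching[OF finL(2) M2] by auto
  have card1: "2 * card M1 = card ?L" and card2: "2 * card M2 = card ?R"
    using perfect_matchingD(1)[OF M1] perfect_matchingD(1)[OF M2] by auto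
  have "card S = 2 + card ?L + card ?R"
  proof -
    have "card S = card ({p, q} \<union> (?L \<union> ?R))"
      using sides_partition(1) by (simp add: Un_assoc)
    also have "\<dots> = card {p, q} + card (?L \<union> ?R)"
      using sides_partition finL by (intro card_Un_disjoint) auto
    also have "card (?L \<union> ?R) = card ?L + card ?R"
      using sides_partition finL by (intro card_Un_disjoint) auto
    finally show ?thesis using pq by simp
  qed
  moreover have "card ?M = Suc (card M1 + card M2)"
    using nin finM by (subst card_insert_disjoint) (auto simp: card_Un_disjoint)
  ultimately have "2 * card ?M = card S"
    using card1 card2 by simp
  moreover have "\<exists>a\<in>S. \<exists>b\<in>S. a \<noteq> b \<and> s = closed_segment a b" if s: "s \<in> ?M" for s
  proof -
    consider "s = ?pq" | "s \<in> M1" | "s \<in> M2" using s by blast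
    then show ?thesis
    proof cases
      case 1
      then show ?thesis using pq by blast
    next
      case 2
      then have "\<exists>a\<in>?L. \<exists>b\<in>?L. a \<noteq> b \<and> s = closed_segment a b"
        by (rule perfect_matchingD(2)[OF M1])
      then show ?thesis unfolding left_of_def by blast
    next
      case 3
      then have "\<exists>a\<in>?R. \<exists>b\<in>?R. a \<noteq> b \<and> s = closed_segment a b"
        by (rule perfect_matchingD(2)[OF M2])
      then show ?thesis unfolding left_of_def by blast
    qed
  qed
  moreover have "s \<inter> t = {}" if st: "s \<in> ?M" "t \<in> ?M" "s \<noteq> t" for s t
  proof -
    have M11: "s \<inter> t = {}" if "s \<in> M1" "t \<in> M1"
      by (rule perfect_matchingD(3)[OF M1 that \<open>s \<noteq> t\<close>])
    have M22: "s \<inter> t = {}" if "s \<in> M2" "t \<in> M2"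
      by (rule perfect_matchingD(3)[OF M2 that \<open>s \<noteq> t\<close>])
    have sym: "t \<inter> s = {} \<Longrightarrow> s \<inter> t = {}" by blast
    consider "s \<in> M1" "t \<in> M1" | "s \<in> M1" "t \<in> M2" | "s \<in> M2" "t \<in> M1" | "s \<in> M2" "t \<in> M2"
      | "s \<in> M1" "t = ?pq" | "s \<in> M2" "t = ?pq" | "s = ?pq" "t \<in> M1" | "s = ?pq" "t \<in> M2"
      using st by blast
    then show ?thesis
      using M11 M22 d1 d2 d12 sym by cases metis+
  qed
  moreover have "\<exists>!s. s \<in> ?M \<and> (\<exists>z. s = closed_segment r z)" if r: "r \<in> S" for r
  proof -
    consider "r \<in> {p, q}" | "r \<in> ?L" | "r \<in> ?R"
      using sides_partition(1) r by blast
    then show ?thesis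
    proof cases
      case 1
      then have "\<not> ccw p q r" "\<not> ccw q p r" by auto
      then have "r \<notin> s" if "s \<in> M1 \<union> M2" for s
        using that s1(1)[of s] s2(1)[of s] by blast
      then have "s = ?pq" if "s \<in> ?M" "\<exists>z. s = closed_segment r z" for s
        using that by (metis Un_iff ends_in_segment(1) insert_iff)
      moreover have "\<exists>z. ?pq = closed_segment r z"
        using 1 closed_segment_commute by blast
      ultimately show ?thesis by blast
    next
      case 2
      \<comment> \<open>A segment with endpoint \<open>r\<close> contains \<open>r\<close>, so only
        \<open>M1\<close> can supply one.\<close>
      then have rs: "r \<notin> s" if "s \<in> M2 \<union> {?pq}" for s
        using that s2(1)[of s] s0 lr[of r] 2 unfolding left_of_def by blast
      have "\<exists>!s. s \<in> M1 \<and> (\<exists>z. s = closed_segment r z)"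
        by (rule perfect_matchingD(4)[OF M1 2])
      moreover have "s \<in> M1" if "s \<in> ?M" "\<exists>z. s = closed_segment r z" for s
        using that rs by (metis Un_iff ends_in_segment(1) insert_iff)
      ultimately show ?thesis by blast
    next
      case 3
      then have rs: "r \<notin> s" if "s \<in> M1 \<union> {?pq}" for s
        using that s1(1)[of s] s0 lr[of r] 3 unfolding left_of_def by blast
      have "\<exists>!s. s \<in> M2 \<and> (\<exists>z. s = closed_segment r z)"
        by (rule perfect_matchingD(4)[OF M2 3])
      moreover have "s \<in> M2" if "s \<in> ?M" "\<exists>z. s = closed_segment r z" for s
        using that rs by (metis Un_iff ends_in_segment(1) insert_iff)
      ultimately show ?thesis by blast
    qed
  qed
  ultimately have "perfect_matching S ?M"
    unfolding perfect_matching_def by (intro conjI ballI impI) simp_all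
  then show ?thesis by (simp add: matchings_with_def)
qed

text \<open>Joining is injective: each part is recovered as the segments inside its half plane. Only
  an inequality results, since a matching may have segments that cross the line outside the segment
  from \<open>p\<close> to \<open>q\<close>.\<close>

lemma card_matchings_with: "card (matchings_with S p q) \<ge> pm (left_of S p q) * pm (left_of S q p)"
proof -
  let ?L = "left_of S p q" and ?R = "left_of S q p"
  let ?join = "\<lambda>(M1, M2). insert (closed_segment p q) (M1 \<union> M2)"
  have separate: "A = {s \<in> insert c (A \<union> B). P s}"
    if "\<And>s. s \<in> A \<Longrightarrow> P s" "\<And>s. s \<in> B \<Longrightarrow> \<not> P s" "\<not> P c" for A B :: "point set set" and P c
    using that by auto
  have recover: "M1 = {s \<in> ?join (M1, M2). s \<subseteq> {r. ccw p q r}} \<and> M2 = {s \<in> ?join (M1, M2). s \<subseteq> {r. ccw q p r}}"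
    if M1: "perfect_matching ?L M1" and M2: "perfect_matching ?R M2" for M1 M2
  proof -
    have s1: "s \<subseteq> {r. ccw p q r} \<and> s \<noteq> {}" if "s \<in> M1" for s
      using matching_subset_convex[OF M1 _ convex_ccw that, of p q] by (auto simp: left_of_def)
    have s2: "s \<subseteq> {r. ccw q p r} \<and> s \<noteq> {}" if "s \<in> M2" for s
      using matching_subset_convex[OF M2 _ convex_ccw that, of q p] by (auto simp: left_of_def)
    have lr: "\<not> (ccw p q r \<and> ccw q p r)" for r
      using ccw_asym[of p q r] ccw_rotate[of q p r] by blast
    have "p \<in> closed_segment p q" "\<not> ccw p q p" "\<not> ccw q p p" by auto
    then have pq: "\<not> closed_segment p q \<subseteq> {r. ccw p q r}" "\<not> closed_segment p q \<subseteq> {r. ccw q p r}"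
      by blast+
    have n2: "\<not> s \<subseteq> {r. ccw p q r}" if "s \<in> M2" for s
      using s2[OF that] lr by blast
    have n1: "\<not> s \<subseteq> {r. ccw q p r}" if "s \<in> M1" for s
      using s1[OF that] lr by blast
    have "M1 = {s \<in> insert (closed_segment p q) (M1 \<union> M2). s \<subseteq> {r. ccw p q r}}"
      using s1 n2 pq by (intro separate) blast+
    moreover have "M2 = {s \<in> insert (closed_segment p q) (M1 \<union> M2). s \<subseteq> {r. ccw q p r}}"
      using s2 n1 pq by (subst Un_commute) (intro separate, blast+)
    ultimately show ?thesis by simp
  qed
  have "inj_on ?join (matchings ?L \<times> matchings ?R)"
  proof (rule inj_on_inverseI[where g = "\<lambda>N. ({s \<in> N. s \<subseteq> {r. ccw p q r}}, {s \<in> N. s \<subseteq> {r. ccw q p r}})"])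
    fix x assume "x \<in> matchings ?L \<times> matchings ?R"
    then obtain M1 M2 where x: "x = (M1, M2)" "perfect_matching ?L M1" "perfect_matching ?R M2"
      by blast
    show "({s \<in> ?join x. s \<subseteq> {r. ccw p q r}}, {s \<in> ?join x. s \<subseteq> {r. ccw q p r}}) = x"
      unfolding x(1) using recover[OF x(2,3)] by (metis (no_types, lifting))
  qed
  then have "card (matchings ?L \<times> matchings ?R) \<le> card (matchings_with S p q)"
    using join_matchings finite_matchings[OF fin]
    by (intro card_inj_on_le[of ?join]) (auto simp: matchings_with_def)
  then show ?thesis by (simp add: pm_def card_cartesian_product)
qed

end

lemma matchings_with_disjoint:
  assumes "p \<in> S" "q \<noteq> r"
  shows "matchings_with S p q \<inter> matchings_with S p r = {}"
proof -
  have "closed_segment p q = closed_segment p r" if "M \<in> matchings_with S p q" "M \<in> matchings_with S p r" for M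
  proof -
    have "perfect_matching S M" "closed_segment p q \<in> M" "closed_segment p r \<in> M"
      using that by (auto simp: matchings_with_def)
    then show ?thesis using perfect_matchingD(4)[of S M p] assms(1) by blast
  qed
  then show ?thesis using assms by (auto simp: doubleton_eq_iff)
qed

lemma matchings_with_commute: "matchings_with S p q = matchings_with S q p"
  by (simp add: matchings_with_def closed_segment_commute)

lemma sum_matchings_with_le:
  assumes "finite S" "p \<in> S" "Q \<subseteq> S"
  shows "(\<Sum>q\<in>Q. card (matchings_with S p q)) \<le> pm S"
proof -
  have fin: "finite (matchings_with S p q)" for q
    using finite_matchings[OF assms(1)] by (auto simp: matchings_with_def)
  have "(\<Sum>q\<in>Q. card (matchings_with S p q)) = card (\<Union>q\<in>Q. matchings_with S p q)"
    using assms fin matchings_with_disjoint finite_subset[OF assms(3)]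
    by (intro card_UN_disjoint[symmetric]) auto
  also have "\<dots> \<le> pm S"
    unfolding pm_def using finite_matchings[OF assms(1)]
    by (intro card_mono) (auto simp: matchings_with_def)
  finally show ?thesis .
qed

section \<open>The lower bound and its equality case\<close>

lemma left_of_radial:
  assumes f: "radially_ordered S p n f"
    and i: "i < n"
  shows "left_of S p (f i) = f ` {i<..<n}" "left_of S (f i) p = f ` {..<i}"
proof -
  have img: "S - {p} = f ` {..<n}" using f by (simp add: bij_betw_def radially_ordered_def)
  have f2: "i < j \<Longrightarrow> j < n \<Longrightarrow> ccw p (f i) (f j)" for i j
    using f by (simp add: radially_ordered_def)
  have order: "ccw p (f i) (f j) \<longleftrightarrow> i < j" if "j < n" for j
    using f2[of i j] f2[of j i] that i ccw_asym[of p "f j" "f i"] by (cases i j rule: linorder_cases) auto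
  have order': "ccw (f i) p (f j) \<longleftrightarrow> j < i" if "j < n" for j
    using f2[of i j] f2[of j i] that i ccw_asym[of p "f i" "f j"] ccw_rotate[of "f i" p "f j"]
    by (cases i j rule: linorder_cases) auto
  have eq: "left_of S a b = {r \<in> f ` {..<n}. ccw a b r}" if "a = p \<or> b = p" for a b
    unfolding img[symmetric] using that by (auto simp: left_of_def)
  have "{r \<in> f ` {..<n}. ccw p (f i) r} = f ` {i<..<n}"
    using order by auto
  then show "left_of S p (f i) = f ` {i<..<n}"
    by (simp add: eq)
  have "{r \<in> f ` {..<n}. ccw (f i) p r} = f ` {..<i}"
    using order' i by auto
  then show "left_of S (f i) p = f ` {..<i}"
    by (simp add: eq)
qed

text \<open>Even positions among the \<open>2 * n + 1\<close> other points are the ones that leave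
  an even number of points on either side of the line. Matchings with different partners of
  \<open>p\<close> are distinct, so the products add up.\<close>

lemma pm_ge_radial_sum:
  assumes S: "finite S" "general_position S" "p \<in> S"
    and n: "card S = 2 * Suc n"
    and f: "radially_ordered S p (2 * n + 1) f"
  shows "(\<Sum>i\<le>n. pm (left_of S p (f (2 * i))) * pm (left_of S (f (2 * i)) p)) \<le> pm S"
    "\<And>i. i \<le> n \<Longrightarrow> card (left_of S p (f (2 * i))) = 2 * (n - i)"
    "\<And>i. i \<le> n \<Longrightarrow> card (left_of S (f (2 * i)) p) = 2 * i"
proof -
  have inj: "inj_on f {..<2 * n + 1}" and img: "f ` {..<2 * n + 1} = S - {p}"
    using f by (auto simp: bij_betw_def radially_ordered_def)
  have inS: "f i \<in> S" "p \<noteq> f i" if "i < 2 * n + 1" for i using img that by auto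
  have inj2: "inj_on (\<lambda>i. f (2 * i)) {..n}"
  proof (rule inj_onI)
    fix i j assume "i \<in> {..n}" "j \<in> {..n}" "f (2 * i) = f (2 * j)"
    then show "i = j" using inj_onD[OF inj, of "2 * i" "2 * j"] by simp
  qed
  have "(\<Sum>i\<le>n. pm (left_of S p (f (2 * i))) * pm (left_of S (f (2 * i)) p))
      \<le> (\<Sum>i\<le>n. card (matchings_with S p (f (2 * i))))"
    using inS S by (intro sum_mono card_matchings_with) auto
  also have "\<dots> = (\<Sum>q\<in>(\<lambda>i. f (2 * i)) ` {..n}. card (matchings_with S p q))"
    by (simp add: sum.reindex[OF inj2])
  also have "\<dots> \<le> pm S"
    using S inS by (intro sum_matchings_with_le) auto
  finally show "(\<Sum>i\<le>n. pm (left_of S p (f (2 * i))) * pm (left_of S (f (2 * i)) p)) \<le> pm S" .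
  show "card (left_of S p (f (2 * i))) = 2 * (n - i)" if "i \<le> n" for i
  proof -
    have "inj_on f {2 * i<..<2 * n + 1}" using inj by (rule inj_on_subset) auto
    then show ?thesis
      using that by (subst left_of_radial(1)[OF f]) (auto simp: card_image)
  qed
  show "card (left_of S (f (2 * i)) p) = 2 * i" if "i \<le> n" for i
  proof -
    have "inj_on f {..<2 * i}" using inj that by (elim inj_on_subset) auto
    then show ?thesis
      using that by (subst left_of_radial(2)[OF f]) (auto simp: card_image)
  qed
qed

lemma left_of_subset: "left_of S p q \<subseteq> S"
  by (auto simp: left_of_def)

theorem pm_ge_catalan:
  assumes "finite S" "general_position S" "card S = 2 * k"
  shows "catalan k \<le> real (pm S)"
  using assms
proof (induction k arbitrary: S rule: less_induct)
  case (less k)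
  show ?case
  proof (cases k)
    case 0
    then show ?thesis using less.prems by (simp add: catalan_def)
  next
    case (Suc n)
    then have card: "card S = 2 * Suc n" "card S - 1 = 2 * n + 1" "S \<noteq> {}" using less.prems by auto
    obtain p where p: "p \<in> S" "extremal S p" using extremal_exists less.prems card by blast
    obtain f where f: "radially_ordered S p (2 * n + 1) f"
      using radial_order[OF less.prems(1,2) p] card by metis
    note sum = pm_ge_radial_sum[OF less.prems(1,2) p(1) card(1) f]
    have IH: "catalan m \<le> real (pm (left_of S a b))" if "card (left_of S a b) = 2 * m" "m \<le> n" for a b m
      using less.IH[of m "left_of S a b"] less.prems left_of_subset that Suc
      by (metis finite_subset general_position_subset le_imp_less_Suc)
    have "catalan k = (\<Sum>i\<le>n. catalan (n - i) * catalan i)"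
      unfolding Suc catalan_convolution by (simp add: mult.commute)
    also have "\<dots> \<le> (\<Sum>i\<le>n. real (pm (left_of S p (f (2 * i))) * pm (left_of S (f (2 * i)) p)))"
      using IH[OF sum(2)] IH[OF sum(3)] less_imp_le[OF catalan_pos]
      by (auto intro!: sum_mono mult_mono)
    also have "\<dots> \<le> real (pm S)"
      using of_nat_mono[OF sum(1), where 'a=real] by (simp only: of_nat_sum)
    finally show ?thesis .
  qed
qed

section \<open>Deleting the endpoints of a hull edge\<close>

lemma left_of_hull_edge:
  assumes "hull_edge S p q"
  shows "left_of S p q = S - {p, q}"
  using assms by (auto simp: hull_edge_def left_of_def)

lemma left_of_hull_edge':
  assumes "hull_edge S p q"
  shows "left_of S q p = {}"
proof -
  have "\<not> ccw q p r" if "r \<in> S" for r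
    using assms that ccw_asym[of p q r] ccw_rotate[of q p r] unfolding hull_edge_def
    by (cases "r = p \<or> r = q") auto
  then show ?thesis by (auto simp: left_of_def)
qed

text \<open>A hull edge contributes the first summand of the convolution.\<close>
lemma pm_hull_edge:
  assumes S: "finite S" "general_position S" "card S = 2 * Suc n" and pq: "hull_edge S p q"
  shows "real (pm (S - {p, q})) + catalan (Suc n) - catalan n \<le> real (pm S)"
proof -
  have p: "p \<in> S" "extremal S p" and q: "q \<in> S - {p}"
    using pq hull_edge_extremal[OF pq] by (auto simp: hull_edge_def)
  have card: "card S - 1 = 2 * n + 1" using S by simp
  obtain f where f: "radially_ordered S p (2 * n + 1) f"
    using radial_order[OF S(1,2) p] card by metis
  note sum = pm_ge_radial_sum[OF S(1,2) p(1) S(3) f]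
  have "q \<in> f ` {..<2 * n + 1}" using q f by (simp add: bij_betw_def radially_ordered_def)
  then obtain i where i: "q = f i" "i < 2 * n + 1" by auto
  \<comment> \<open>The \<open>i\<close> points preceding \<open>q\<close> lie to the right of the
    edge, where there are none.\<close>
  have "i = 0"
    using left_of_radial(2)[OF f i(2)] left_of_hull_edge'[OF pq] i(1) by auto
  then have q0: "q = f (2 * 0)" using i by simp
  have LB: "catalan m \<le> real (pm (left_of S a b))" if "card (left_of S a b) = 2 * m" for a b m
    using pm_ge_catalan[of "left_of S a b"] S left_of_subset that finite_subset general_position_subset by metis
  \<comment> \<open>The summand for \<open>i = 0\<close> is
    \<open>catalan n * catalan 0 = catalan n\<close>. The remaining ones are bounded by the general
    lower bound.\<close>
  have "catalan (Suc n) - catalan n = (\<Sum>i\<in>{..n} - {0}. catalan (n - i) * catalan i)"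
    unfolding catalan_convolution by (simp add: sum_diff1 catalan_def[of 0] mult.commute)
  also have "\<dots> \<le> (\<Sum>i\<in>{..n} - {0}. real (pm (left_of S p (f (2 * i))) * pm (left_of S (f (2 * i)) p)))"
    using LB[OF sum(2)] LB[OF sum(3)] less_imp_le[OF catalan_pos]
    by (auto intro!: sum_mono mult_mono)
  also have "\<dots> = (\<Sum>i\<le>n. real (pm (left_of S p (f (2 * i))) * pm (left_of S (f (2 * i)) p)))
      - real (pm (S - {p, q}))"
    using left_of_hull_edge[OF pq] left_of_hull_edge'[OF pq] q0 by (simp add: sum_diff1)
  also have "(\<Sum>i\<le>n. real (pm (left_of S p (f (2 * i))) * pm (left_of S (f (2 * i)) p))) \<le> real (pm S)"
    using of_nat_mono[OF sum(1), where 'a=real] by (simp only: of_nat_sum)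
  finally show ?thesis by simp
qed

lemma general_position_Diff: "general_position S \<Longrightarrow> general_position (S - T)"
  by (rule general_position_subset) auto

text \<open>Equality for \<open>S\<close> leaves no slack in \<open>pm_hull_edge\<close>, and the
  general lower bound gives the other inequality. This is what carries the induction.\<close>

lemma pm_Diff_hull_edge:
  assumes S: "finite S" "general_position S" "card S = 2 * Suc n" and pq: "hull_edge S p q"
    and pm: "real (pm S) = catalan (Suc n)"
  shows "card (S - {p, q}) = 2 * n" "real (pm (S - {p, q})) = catalan n"
proof -
  have "p \<in> S" "q \<in> S" "p \<noteq> q" using pq by (auto simp: hull_edge_def)
  then show card: "card (S - {p, q}) = 2 * n" using S by (simp add: card_Diff_subset)
  have "catalan n \<le> real (pm (S - {p, q}))"
    using pm_ge_catalan[of "S - {p, q}" n] S card general_position_Diff by auto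
  then show "real (pm (S - {p, q})) = catalan n"
    using pm_hull_edge[OF S pq] pm by simp
qed

lemma card_matchings_with_hull_edge:
  assumes S: "finite S" "general_position S" "card S = 2 * Suc n" and pq: "hull_edge S p q"
  shows "catalan n \<le> real (card (matchings_with S p q))"
proof -
  have pq': "p \<in> S" "q \<in> S" "p \<noteq> q" using pq by (auto simp: hull_edge_def)
  then have "card (S - {p, q}) = 2 * n" using S by (simp add: card_Diff_subset)
  then have "catalan n \<le> real (pm (S - {p, q}))"
    using pm_ge_catalan[of "S - {p, q}" n] S general_position_Diff by auto
  also have "\<dots> \<le> real (card (matchings_with S p q))"
    using card_matchings_with[OF S(1,2) pq'] left_of_hull_edge[OF pq] left_of_hull_edge'[OF pq] by simp
  finally show ?thesis .
qed

text \<open>Any two of the three edges share an endpoint, so no matching contains two of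
  them.\<close>

lemma pm_triangular_hull:
  assumes S: "finite S" "general_position S" "card S = 2 * Suc n"
    and abc: "hull_edge S a b" "hull_edge S b c" "hull_edge S c a"
  shows "3 * catalan n \<le> real (pm S)"
proof -
  let ?A = "matchings_with S a b" and ?B = "matchings_with S b c" and ?C = "matchings_with S c a"
  have in_S: "a \<in> S" "b \<in> S" "c \<in> S" and ne: "a \<noteq> b" "b \<noteq> c" "c \<noteq> a"
    using abc by (auto simp: hull_edge_def)
  have sub: "?A \<subseteq> matchings S" "?B \<subseteq> matchings S" "?C \<subseteq> matchings S"
    by (auto simp: matchings_with_def)
  then have fin: "finite ?A" "finite ?B" "finite ?C"
    using finite_matchings[OF S(1)] finite_subset by blast+
  have dis: "?A \<inter> ?B = {}" "?B \<inter> ?C = {}" "?A \<inter> ?C = {}"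
    using matchings_with_disjoint[of b S a c] matchings_with_disjoint[of c S b a]
      matchings_with_disjoint[of a S b c] in_S ne
    by (auto simp: matchings_with_commute)
  have "card ?A + card ?B + card ?C = card (?A \<union> ?B \<union> ?C)"
    using fin dis by (simp add: card_Un_disjoint Int_Un_distrib2)
  also have "\<dots> \<le> pm S"
    unfolding pm_def using finite_matchings[OF S(1)] sub by (intro card_mono) auto
  finally show ?thesis
    using card_matchings_with_hull_edge[OF S abc(1)] card_matchings_with_hull_edge[OF S abc(2)]
      card_matchings_with_hull_edge[OF S abc(3)] by linarith
qed

section \<open>The hull polygon\<close>

text \<open>The vertices are indexed periodically by all natural numbers, so that cyclic index
  arithmetic needs no modulus.\<close>
definition hull_polygon :: "point set \<Rightarrow> nat \<Rightarrow> (nat \<Rightarrow> point) \<Rightarrow> bool" where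
  "hull_polygon S h A \<longleftrightarrow> 3 \<le> h \<and> range A = {p \<in> S. extremal S p} \<and> (\<forall>i. A (i + h) = A i) \<and>
     (\<forall>i a b. 0 < a \<longrightarrow> a < b \<longrightarrow> b < h \<longrightarrow> ccw (A i) (A (i + a)) (A (i + b))) \<and>
     (\<forall>i. hull_edge S (A i) (A (i + 1)))"

text \<open>The first point in radial order around \<open>p\<close> is the other end of the
  edge.\<close>

lemma hull_edge_exists:
  assumes "finite S" "general_position S" "p \<in> S" "extremal S p" "2 \<le> card S"
  shows "\<exists>q. hull_edge S p q"
proof -
  obtain f where f: "radially_ordered S p (card S - 1) f"
    using radial_order assms by blast
  have img: "S - {p} = f ` {..<card S - 1}"
    using f by (simp add: radially_ordered_def bij_betw_def)
  have "f 0 \<in> S - {p}" unfolding img using assms by auto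
  moreover have "ccw p (f 0) r" if "r \<in> S - {p, f 0}" for r
  proof -
    have "r \<in> f ` {..<card S - 1}" using that img by auto
    then obtain j where "r = f j" "j < card S - 1" by auto
    then show ?thesis
      using that f unfolding radially_ordered_def by (cases j) auto
  qed
  ultimately have "hull_edge S p (f 0)" using assms(3) unfolding hull_edge_def by blast
  then show ?thesis ..
qed

lemma hull_edge_unique:
  assumes "hull_edge S p q" "hull_edge S p r"
  shows "q = r"
proof (rule ccontr)
  assume "q \<noteq> r"
  then have "ccw p q r" "ccw p r q"
    using assms unfolding hull_edge_def by blast+
  then show False using ccw_asym by blast
qed

lemma hull_edge_subset:
  assumes "hull_edge S p q" "T \<subseteq> S" "p \<in> T" "q \<in> T"
  shows "hull_edge T p q"
  using assms unfolding hull_edge_def by blast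

text \<open>Reduction modulo \<open>h\<close> rotates a sorted triple cyclically. The cases are
  distinguished by how many of the shifted indices wrap around.\<close>

lemma cyclic_ccw:
  fixes B :: "nat \<Rightarrow> point"
  assumes B: "\<And>i j k. i < j \<Longrightarrow> j < k \<Longrightarrow> k < h \<Longrightarrow> ccw (B i) (B j) (B k)"
    and ab: "0 < a" "a < b" "b < h"
  shows "ccw (B (i mod h)) (B ((i + a) mod h)) (B ((i + b) mod h))"
proof -
  define r where "r = i mod h"
  have r: "r < h" using ab by (simp add: r_def)
  have shift: "(i + c) mod h = (if r + c < h then r + c else r + c - h)" if "c < h" for c
  proof -
    have "(i + c) mod h = (r + c) mod h" by (simp add: r_def mod_simps)
    then show ?thesis using r that by (simp add: mod_if)
  qed
  consider "r + b < h" | "r + a < h" "h \<le> r + b" | "h \<le> r + a" by linarith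
  then have "ccw (B r) (B ((i + a) mod h)) (B ((i + b) mod h))"
  proof cases
    case 1
    then have "(i + a) mod h = r + a" "(i + b) mod h = r + b"
      using shift[of a] shift[of b] ab by auto
    then show ?thesis using B[of r "r + a" "r + b"] ab 1 by simp
  next
    case 2
    then have "ccw (B (r + b - h)) (B r) (B (r + a))" using ab r by (intro B) auto
    moreover have "(i + a) mod h = r + a" "(i + b) mod h = r + b - h"
      using shift[of a] shift[of b] ab 2 by auto
    ultimately show ?thesis
      by (simp only:) (rule ccw_rotate[THEN iffD1])
  next
    case 3
    then have "ccw (B (r + a - h)) (B (r + b - h)) (B r)" using ab r by (intro B) auto
    moreover have "(i + a) mod h = r + a - h" "(i + b) mod h = r + b - h"
      using shift[of a] shift[of b] ab 3 by auto
    ultimately show ?thesis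
      by (simp only:) (rule ccw_rotate[THEN iffD2])
  qed
  then show ?thesis by (simp add: r_def)
qed

text \<open>The extremal points are sorted radially around one of them, \<open>p\<close>. A
  clockwise triple among the others would put its middle point inside a triangle with corner
  \<open>p\<close>. A hull edge that skipped a vertex would have that vertex on both sides.\<close>

lemma hull_polygon_exists:
  assumes S: "finite S" "general_position S" "3 \<le> card S"
  obtains h A where "hull_polygon S h A"
proof -
  define H where "H = {p \<in> S. extremal S p}"
  have H: "finite H" "general_position H" using S general_position_subset by (auto simp: H_def)
  obtain p where "p \<in> S" "extremal S p" using extremal_exists[of S] S by fastforce
  then have p: "p \<in> H" "extremal H p" using extremal_subset[of S p H] by (auto simp: H_def)
  obtain f where f: "radially_ordered H p (card H - 1) f"
    using radial_order[OF H p] .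
  define h where "h = card H"
  define B where "B i = (case i of 0 \<Rightarrow> p | Suc j \<Rightarrow> f j)" for i
  have h0: "0 < h" using p H by (auto simp: h_def card_gt_0_iff)
  have img: "B ` {..<h} = H"
  proof -
    have "{..<h} = insert 0 (Suc ` {..<h - 1})"
      using lessThan_Suc_eq_insert_0[of "h - 1"] h0 by simp
    moreover have "f ` {..<h - 1} = H - {p}"
      using f by (simp add: radially_ordered_def bij_betw_def h_def)
    ultimately show ?thesis using p by (simp add: B_def image_image insert_absorb)
  qed
  have B: "ccw (B i) (B j) (B k)" if ijk: "i < j" "j < k" "k < h" for i j k
  proof -
    have from_p: "ccw p (B j) (B k)" if jk: "0 < j" "j < k" "k < h" for j k
    proof -
      obtain j' k' where "j = Suc j'" "k = Suc k'"
        using jk by (metis gr0_implies_Suc less_trans)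
      then show ?thesis
        using f jk unfolding radially_ordered_def B_def h_def by simp
    qed
    show ?thesis
    proof (cases "i = 0")
      case True
      then show ?thesis using from_p ijk by (simp add: B_def)
    next
      case False
      have pij: "ccw p (B i) (B j)" and pjk: "ccw p (B j) (B k)" and pik: "ccw p (B i) (B k)"
        using from_p False ijk by auto
      have inH: "B i \<in> H" "B j \<in> H" "B k \<in> H" using img ijk by auto
      show ?thesis
      proof (rule ccontr)
        assume "\<not> ccw (B i) (B j) (B k)"
        moreover have "B i \<noteq> B j" "B j \<noteq> B k" "B i \<noteq> B k" using pij pjk pik by auto
        ultimately have "ccw (B i) (B k) (B j)"
          using general_position_ccw[OF H(2) inH] by blast
        then have "in_tri p (B i) (B k) (B j)"
          using pij pjk ccw_rotate[of "B k" p "B j"] by (simp add: in_tri_def)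
        then show False using inH p unfolding H_def extremal_def by blast
      qed
    qed
  qed
  define A where "A i = B (i mod h)" for i
  have ccwA: "ccw (A i) (A (i + a)) (A (i + b))" if "0 < a" "a < b" "b < h" for i a b
    unfolding A_def using cyclic_ccw[of h B] B that by blast
  have ran: "range A = H"
  proof -
    have "range (\<lambda>i. i mod h) = {..<h}"
    proof
      show "{..<h} \<subseteq> range (\<lambda>i. i mod h)"
        by (auto intro: image_eqI[of j "\<lambda>i. i mod h" j for j])
    qed (use h0 in auto)
    then have "B ` range (\<lambda>i. i mod h) = H" using img by simp
    then show ?thesis by (simp add: A_def image_image)
  qed
  have edge: "hull_edge S (A i) (A (i + 1))" for i
  proof -
    have "A i \<in> H" using ran by blast
    then obtain q where q: "hull_edge S (A i) q"
      using hull_edge_exists[of S "A i"] S by (auto simp: H_def)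
    then have "q \<in> H" using hull_edge_extremal[OF q] by (auto simp: H_def hull_edge_def)
    then obtain j where j: "j < h" "q = B j" using img by auto
    define r where "r = i mod h"
    have r: "r < h" using h0 by (simp add: r_def)
    \<comment> \<open>Adding \<open>h\<close> makes the natural subtraction exact, as
      \<open>r < h\<close>; the shift is reduced modulo \<open>h\<close> afterwards.\<close>
    have "q = A (i + (j + h - r))"
    proof -
      have "(i + (j + h - r)) mod h = (r + (j + h - r)) mod h" by (simp add: r_def mod_simps)
      also have "\<dots> = j" using r j by simp
      finally show ?thesis using j by (simp add: A_def)
    qed
    moreover have "A (i + (j + h - r)) = A (i + (j + h - r) mod h)"
      by (simp add: A_def mod_simps)
    ultimately obtain a where a: "a < h" "q = A (i + a)" using h0 by (metis mod_less_divisor)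
    have "a \<noteq> 0" using q a by (cases a) (auto simp: hull_edge_def)
    moreover have "\<not> 1 < a"
    proof
      assume "1 < a"
      then have c: "ccw (A i) (A (i + 1)) q" using ccwA[of 1 a i] a by simp
      then have "A (i + 1) \<in> S - {A i, q}" using ran H_def by auto
      then have "ccw (A i) q (A (i + 1))" using q by (auto simp: hull_edge_def)
      then show False using c ccw_asym by blast
    qed
    ultimately have "a = 1" by simp
    then show ?thesis using q a by simp
  qed
  have per: "A (i + h) = A i" for i by (simp add: A_def)
  have "3 \<le> h"
  proof (rule ccontr)
    assume "\<not> 3 \<le> h"
    then consider "h = 1" | "h = 2" using h0 by linarith
    then show False
    proof cases
      case 1
      then show ?thesis using edge[of 0] per[of 0] by (auto simp: hull_edge_def)
    next
      case 2
      have "card {A 0, A 1} \<le> 2" by (simp add: card_insert_if)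
      then have "\<not> S \<subseteq> {A 0, A 1}" using S(3) card_mono[of "{A 0, A 1}" S] by auto
      then obtain r where "r \<in> S" "r \<noteq> A 0" "r \<noteq> A 1" by blast
      then have "ccw (A 0) (A 1) r" "ccw (A 1) (A 0) r"
        using edge[of 0] edge[of 1] per[of 0] 2 by (auto simp: hull_edge_def numeral_2_eq_2)
      then show ?thesis using ccw_asym[of "A 0" "A 1" r] ccw_rotate[of "A 1" "A 0" r] by blast
    qed
  qed
  then have "hull_polygon S h A"
    unfolding hull_polygon_def using ran ccwA edge per by (simp add: H_def)
  then show thesis using that by blast
qed

section \<open>Cyclic indexing and interior points of the hull polygon\<close>

context
  fixes S :: "point set" and h :: nat and A :: "nat \<Rightarrow> point"
  assumes gp: "general_position S" and poly: "hull_polygon S h A"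
begin

lemma polygon_ge_3: "3 \<le> h"
  and polygon_range: "range A = {p \<in> S. extremal S p}"
  and polygon_period: "A (i + h) = A i"
  and polygon_ccw: "0 < a \<Longrightarrow> a < b \<Longrightarrow> b < h \<Longrightarrow> ccw (A i) (A (i + a)) (A (i + b))"
  and polygon_edge: "hull_edge S (A i) (A (i + 1))"
  using poly unfolding hull_polygon_def by blast+

lemma polygon_in: "A i \<in> S"
  using polygon_range by auto

lemma polygon_period_mult: "A (i + h * n) = A i"
proof (induction n)
  case (Suc n)
  have "i + h * Suc n = i + h * n + h" by simp
  then show ?case using Suc polygon_period[of "i + h * n"] by (simp only:)
qed simp

lemma polygon_mod: "A (i + j mod h) = A (i + j)"
  using polygon_period_mult[of "i + j mod h" "j div h"] by (simp add: add.assoc)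

lemma polygon_neq:
  assumes "0 < a" "a < h"
  shows "A i \<noteq> A (i + a)"
proof (cases "a = 1")
  case True
  then show ?thesis using polygon_ccw[of 1 2 i] polygon_ge_3 by auto
next
  case False
  then show ?thesis using polygon_ccw[of 1 a i] assms by auto
qed

lemma polygon_neq':
  assumes "a < b" "b < a + h"
  shows "A a \<noteq> A b" "A b \<noteq> A a"
  using polygon_neq[of "b - a" a] assms less_diff_conv2[of a b h] by (simp_all add: add.commute)

lemma polygon_vertex: "p \<in> range A \<Longrightarrow> \<exists>a<h. p = A (i + a)"
proof -
  assume "p \<in> range A"
  then obtain j where "p = A j" by auto
  \<comment> \<open>The multiple \<open>h * i\<close> of the period makes the subtraction of
    \<open>i\<close> exact.\<close>
  then have "p = A (i + (j + h * i - i))"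
    using polygon_period_mult[of j i] polygon_ge_3 by (simp add: trans_le_add2)
  then have "p = A (i + (j + h * i - i) mod h)" by (simp add: polygon_mod)
  moreover have "(j + h * i - i) mod h < h" using polygon_ge_3 by simp
  ultimately show ?thesis by blast
qed

lemma polygon_card: "card (range A) = h"
proof -
  have "inj_on A {..<h}"
  proof (rule inj_onI)
    fix i j assume "i \<in> {..<h}" "j \<in> {..<h}" "A i = A j"
    then show "i = j"
      using polygon_neq'[of i j] polygon_neq'[of j i] by (cases i j rule: linorder_cases) auto
  qed
  moreover have "range A = A ` {..<h}"
    using polygon_vertex[of _ 0] by auto
  ultimately show ?thesis by (simp add: card_image)
qed

lemma polygon_next: "A i = A j \<Longrightarrow> A (i + 1) = A (j + 1)"
  using hull_edge_unique[OF polygon_edge[of i]] polygon_edge[of j] by simp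

lemma polygon_interior:
  assumes "x \<in> S - range A"
  shows "ccw (A i) (A (i + 1)) x"
  using polygon_edge[of i] assms unfolding hull_edge_def by blast

lemma polygon_side:
  assumes "x \<in> S - range A" "A i \<noteq> A j"
  shows "ccw (A i) (A j) x \<longleftrightarrow> \<not> ccw (A j) (A i) x"
proof -
  have "x \<in> S" "A i \<noteq> x" "A j \<noteq> x" using assms by auto
  then have "ccw (A i) (A j) x \<or> ccw (A i) x (A j)"
    using general_position_ccw[OF gp polygon_in polygon_in] assms by metis
  then show ?thesis
    using ccw_rotate[of "A j" "A i" x] ccw_asym[of "A i" "A j" x] by metis
qed

text \<open>The diagonals from \<open>A i\<close> triangulate the polygon. The point
  \<open>x\<close> is left of the first hull edge at \<open>A i\<close> and right of the last one,
  so its side changes between two consecutive vertices.\<close>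

lemma polygon_fan:
  assumes x: "x \<in> S - range A"
  obtains j where "0 < j" "j + 1 < h" "in_tri (A i) (A (i + j)) (A (i + j + 1)) x"
proof -
  let ?P = "\<lambda>j. ccw (A i) (A (i + j)) x"
  have last: "\<not> ?P (h - 2 + 1)"
  proof -
    have h: "h - 2 + 1 < h" "0 < h - 2 + 1" "i + (h - 2 + 1) + 1 = i + h" using polygon_ge_3 by auto
    then have "ccw (A (i + (h - 2 + 1))) (A i) x"
      using polygon_interior[OF x, of "i + (h - 2 + 1)"] polygon_period[of i] by metis
    then show ?thesis
      using polygon_side[OF x polygon_neq[OF h(2,1), of i]] by blast
  qed
  define j where "j = (LEAST j. \<not> ?P (j + 1))"
  have nP: "\<not> ?P (j + 1)"
    unfolding j_def using last by (rule LeastI)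
  have P1: "?P 1" using polygon_interior[OF x, of i] .
  have j0: "0 < j"
  proof (rule ccontr)
    assume "\<not> 0 < j"
    then have "j + 1 = 1" by simp
    then show False using nP P1 by metis
  qed
  have "?P (j - 1 + 1)"
    using not_less_Least[of "j - 1" "\<lambda>j. \<not> ?P (j + 1)"] j0 unfolding j_def[symmetric] by simp
  then have "?P j" using j0 by simp
  have "j \<le> h - 2"
    unfolding j_def using last by (rule Least_le)
  then have jh: "j + 1 < h" using polygon_ge_3 by linarith
  have "ccw (A (i + (j + 1))) (A i) x"
    using nP polygon_side[OF x polygon_neq[of "j + 1" i]] jh by simp
  then have "in_tri (A i) (A (i + j)) (A (i + j + 1)) x"
    using \<open>?P j\<close> polygon_interior[OF x, of "i + j"] by (simp add: in_tri_def)
  then show thesis using that j0 jh by blast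
qed

text \<open>The ray from \<open>y\<close> through \<open>x\<close> leaves the hull through the edge \<open>A i, A (i + 1)\<close>.\<close>
lemma polygon_exit:
  assumes x: "x \<in> S - range A" and y: "y \<in> S - range A" and "x \<noteq> y"
  obtains i where "in_tri (A i) (A (i + 1)) y x"
proof -
  obtain j where tri: "in_tri (A 0) (A (0 + j)) (A (0 + j + 1)) y"
    using polygon_fan[OF y, of 0] by blast
  let ?Q = "\<lambda>i. ccw y x (A i)"
  have Qneg: "\<not> ?Q i \<longleftrightarrow> ccw x y (A i)" for i
  proof -
    have "x \<in> S" "y \<in> S" "x \<noteq> A i" "y \<noteq> A i" using x y by auto
    then have "ccw y x (A i) \<or> ccw y (A i) x"
      using general_position_ccw[OF gp, of y x "A i"] polygon_in[of i] \<open>x \<noteq> y\<close> by metis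
    then show ?thesis
      using ccw_rotate[of x y "A i"] ccw_asym[of y x "A i"] by metis
  qed
  \<comment> \<open>Since \<open>y\<close> lies in a triangle of hull vertices, there are vertices
    on both sides of the line through \<open>x\<close> and \<open>y\<close>.\<close>
  obtain u where u: "\<not> ?Q u" using in_tri_not_one_side[OF tri, of x] by blast
  obtain v where v: "?Q v" using in_tri_not_one_side'[OF tri, of x] Qneg by blast
  define j where "j = (LEAST j. ?Q (u + j))"
  have "u + (v + h * u - u) = v + h * u" using polygon_ge_3 by (simp add: trans_le_add2)
  then have "?Q (u + (v + h * u - u))" using v by (simp only: polygon_period_mult)
  then have Qj: "?Q (u + j)" unfolding j_def by (rule LeastI)
  then obtain i where i: "j = i + 1" using u by (cases j) auto
  have "\<not> ?Q (u + i)"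
    using not_less_Least[of i "\<lambda>j. ?Q (u + j)"] i by (simp add: j_def)
  \<comment> \<open>This edge crosses the line from the right side of \<open>y x\<close> to the
    left, and \<open>x\<close> is left of the edge itself.\<close>
  then have "in_tri (A (u + i)) (A (u + i + 1)) y x"
    using Qj Qneg[of "u + i"] i polygon_interior[OF x, of "u + i"]
      ccw_rotate[of y x "A (u + i + 1)"] ccw_rotate[of x "A (u + i + 1)" y]
      ccw_rotate[of x y "A (u + i)"]
    by (simp add: in_tri_def add.assoc)
  then show thesis using that by blast
qed

end

text \<open>If \<open>y\<close> precedes \<open>z\<close> around \<open>x\<close> and the first two alternatives fail, then \<open>u\<close>, \<open>v\<close> and \<open>x\<close> all lie
  to the left of the line from \<open>y\<close> to \<open>z\<close>, although \<open>y\<close> lies inside their triangle.\<close>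
lemma two_points_in_triangle:
  assumes gp: "general_position S" "{u, v, x, y, z} \<subseteq> S" and yz: "y \<noteq> z"
    and tri: "in_tri u v x y" "in_tri u v x z"
  shows "in_tri x u z y \<or> in_tri x y v z \<or> in_tri x u y z \<or> in_tri x z v y"
proof -
  have *: "in_tri x u z y \<or> in_tri x y v z"
    if o: "ccw x y z" and tri: "in_tri u v x y" "in_tri u v x z" and S: "{u, v, x, y, z} \<subseteq> S" for y z
  proof (rule ccontr)
    assume neg: "\<not> (in_tri x u z y \<or> in_tri x y v z)"
    have ne: "u \<noteq> y" "u \<noteq> z" "v \<noteq> y" "v \<noteq> z" "y \<noteq> z"
      using tri o by (auto simp: in_tri_def)
    have "\<not> ccw u z y"
      using neg tri o ccw_rotate[of z x y] by (auto simp: in_tri_def)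
    then have 1: "ccw y z u"
      using general_position_ccw[OF gp(1), of u z y] S ne ccw_rotate[of u y z] by auto
    have "\<not> ccw y v z"
      using neg tri o by (auto simp: in_tri_def)
    then have 2: "ccw y z v"
      using general_position_ccw[OF gp(1), of y v z] S ne by auto
    have 3: "ccw y z x" using o ccw_rotate[of x y z] by simp
    show False using in_tri_not_one_side[OF tri(1) 1 2 3] .
  qed
  \<comment> \<open>Exchanging \<open>y\<close> and \<open>z\<close> turns the first two
    alternatives into the last two.\<close>
  have "ccw x y z \<or> ccw x z y"
  proof (rule general_position_ccw[OF gp(1) _ _ _ _ yz])
    show "x \<noteq> y" "x \<noteq> z" using tri by (auto simp: in_tri_def)
  qed (use gp(2) in auto)
  then show ?thesis using *[of y z] *[of z y] tri gp(2) by blast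
qed

section \<open>Configurations attaining the bound\<close>

text \<open>The last condition places \<open>x\<close> in the small pentagon cut out by the five
  diagonals.\<close>

definition pentagon_type :: "point set \<Rightarrow> bool" where
  "pentagon_type S \<longleftrightarrow> (\<exists>A x. hull_polygon S 5 A \<and> x \<notin> range A \<and> S = insert x (range A) \<and>
     (\<forall>i. ccw (A i) (A (i + 2)) x))"

lemma pentagon_type_unique_interior:
  assumes "pentagon_type S" "x \<in> S" "y \<in> S" "\<not> extremal S x" "\<not> extremal S y"
  shows "x = y"
proof -
  obtain A q where A: "hull_polygon S 5 A" "S = insert q (range A)"
    using assms(1) unfolding pentagon_type_def by blast
  then have "range A = {p \<in> S. extremal S p}" by (simp add: hull_polygon_def)
  then have "x \<notin> range A" "y \<notin> range A" using assms by blast+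
  then show ?thesis using assms(2,3) A(2) by blast
qed

text \<open>The diagonals \<open>A i\<close>, \<open>A (i + 2)\<close> and \<open>A (i + 4)\<close>,
  \<open>A (i + 1)\<close> separate the inner point from the triangles with apex
  \<open>A (i + 2)\<close> and \<open>A (i + 4)\<close>. Only the opposite vertex
  \<open>A (i + 3)\<close> remains.\<close>

lemma pentagon_type_unique_apex:
  assumes gp: "general_position S" and S: "pentagon_type S" "hull_edge S u v" "x \<in> S" "y \<in> S" "z \<in> S"
    and tri: "in_tri u v y x" "in_tri u v z x"
  shows "y = z"
proof -
  obtain A q where A: "hull_polygon S 5 A" "q \<notin> range A" "S = insert q (range A)"
      and q: "\<And>i. ccw (A i) (A (i + 2)) q"
    using S(1) unfolding pentagon_type_def by blast
  note poly = gp A(1)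
  have ran: "range A = {p \<in> S. extremal S p}" by (rule polygon_range[OF poly])
  have uv: "u \<in> S" "v \<in> S" using S(2) by (auto simp: hull_edge_def)
  have "\<not> extremal S x" using tri(1) uv S(4) by (auto simp: extremal_def)
  then have x: "x = q" using S(3) A(3) ran by blast
  have "u \<in> range A" using hull_edge_extremal[OF S(2)] uv ran by blast
  then obtain i where u: "u = A i" by auto
  then have v: "v = A (i + 1)"
    using hull_edge_unique[OF S(2)] polygon_edge[OF poly, of i] by blast
  have apex: "w = A (i + 3)" if w: "w \<in> S" "in_tri u v w x" for w
  proof -
    have "w \<noteq> q" using w(2) x by (auto simp: in_tri_def)
    then have "w \<in> range A" using w A(3) by blast
    then obtain a where a: "a < 5" "w = A (i + a)"
      using polygon_vertex[OF poly, of w i] by blast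
    have "w \<noteq> u" "w \<noteq> v" using w(2) by (auto simp: in_tri_def)
    then have "a \<noteq> 0" "a \<noteq> 1" using a u v by (metis add_0_right, metis)
    moreover have "a \<noteq> 2"
    proof
      assume "a = 2"
      then have "ccw (A (i + 2)) (A i) q" using w(2) a u x by (simp add: in_tri_def)
      then show False using q[of i] ccw_asym ccw_rotate by blast
    qed
    moreover have "a \<noteq> 4"
    proof
      assume "a = 4"
      then have "ccw (A (i + 1)) (A (i + 4)) q" using w(2) a v x by (simp add: in_tri_def)
      moreover have "A (i + 4 + 2) = A (i + 1)"
        using polygon_period[OF poly, of "i + 1"] by (simp add: add.commute)
      then have "ccw (A (i + 4)) (A (i + 1)) q" using q[of "i + 4"] by metis
      ultimately show False using ccw_asym ccw_rotate by blast
    qed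
    ultimately have "a = 3" using a(1) by linarith
    then show ?thesis using a by simp
  qed
  show ?thesis using apex[of y] apex[of z] S(4,5) tri by simp
qed

lemma not_extremal_in_tri: "in_tri a b c x \<Longrightarrow> {a, b, c} \<subseteq> S \<Longrightarrow> \<not> extremal S x"
  unfolding extremal_def by blast

text \<open>Otherwise \<open>x\<close> would stay on the same side of a long diagonal while that is turned around
  vertex by vertex until its direction is reversed.\<close>
lemma heptagon_triangle:
  assumes gp: "general_position S" and A: "hull_polygon S 7 A" and x: "x \<in> S - range A"
  obtains i where "in_tri (A i) (A (i + 1)) (A (i + 4)) x"
proof (rule ccontr)
  assume "\<not> thesis"
  then have no: "\<not> in_tri (A i) (A (i + 1)) (A (i + 4)) x" for i using that by blast
  note poly = gp A
  define lf where "lf i j \<longleftrightarrow> ccw (A i) (A j) x" for i j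
  have per: "A (i + 7) = A i" for i by (rule polygon_period[OF poly])
  have opp: "lf i j \<longleftrightarrow> \<not> lf j i" if "i < j" "j < i + 7" for i j
    unfolding lf_def by (rule polygon_side[OF poly x]) (rule polygon_neq'[OF poly that])
  \<comment> \<open>One direction is the assumption that no such triangle contains \<open>x\<close>;
    the other compares directions around \<open>A (i + 4)\<close>.\<close>
  have turn: "lf (i + 1) (i + 4) \<longleftrightarrow> lf i (i + 4)" for i
  proof
    assume "lf (i + 1) (i + 4)"
    then have "\<not> lf (i + 4) i"
      using no[of i] polygon_interior[OF poly x, of i] by (auto simp: in_tri_def lf_def)
    then show "lf i (i + 4)" using opp[of i "i + 4"] by simp
  next
    assume "lf i (i + 4)"
    have e7: "A (i + 4 + 3) = A i" "A (i + 4 + 4) = A (i + 1)"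
    proof -
      have "i + 4 + 3 = i + 7" "i + 4 + 4 = i + 1 + 7" by simp_all
      then show "A (i + 4 + 3) = A i" "A (i + 4 + 4) = A (i + 1)"
        by (simp_all only: per)
    qed
    have "ccw (A (i + 4)) x (A (i + 1))"
    proof (rule ccw_trans)
      show "ccw (A (i + 4)) (A (i + 4 + 1)) x" using polygon_interior[OF poly x] .
      show "ccw (A (i + 4)) (A (i + 4 + 1)) (A i)"
        using polygon_ccw[OF poly, of 1 3 "i + 4"] unfolding e7 by simp
      show "ccw (A (i + 4)) (A (i + 4 + 1)) (A (i + 1))"
        using polygon_ccw[OF poly, of 1 4 "i + 4"] unfolding e7 by simp
      show "ccw (A (i + 4)) x (A i)"
        using \<open>lf i (i + 4)\<close> ccw_rotate[of "A i" "A (i + 4)" x] by (simp add: lf_def)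
      show "ccw (A (i + 4)) (A i) (A (i + 1))"
        using polygon_ccw[OF poly, of 3 4 "i + 4"] unfolding e7 by simp
    qed
    then show "lf (i + 1) (i + 4)"
      using ccw_rotate[of "A (i + 1)" "A (i + 4)" x] by (simp add: lf_def)
  qed
  have per': "A 7 = A 0" "A 8 = A 1" "A 9 = A 2" "A 10 = A 3"
    using per[of 0] per[of 1] per[of 2] per[of 3] by simp_all
  have wrap: "lf i 7 = lf i 0" "lf i 8 = lf i 1" "lf i 9 = lf i 2" "lf i 10 = lf i 3"
      "lf 7 i = lf 0 i" "lf 8 i = lf 1 i" "lf 9 i = lf 2 i" for i
    unfolding lf_def per' by simp_all
  have "(1::nat) + 1 = 2" "(1::nat) + 4 = 5" by simp_all
  then have "lf 2 5 = lf 1 5" using turn[of 1] by (simp only:)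
  moreover have "lf 1 4 = lf 0 4" "lf 3 6 = lf 2 6" "lf 4 0 = lf 3 0" "lf 5 1 = lf 4 1"
      "lf 6 2 = lf 5 2" "lf 0 3 = lf 6 3"
    using turn[of 0] turn[of 2] turn[of 3] turn[of 4] turn[of 5] turn[of 6]
    by (simp_all add: wrap)
  moreover have "lf 4 0 = (\<not> lf 0 4)" "lf 3 0 = (\<not> lf 0 3)" "lf 6 3 = (\<not> lf 3 6)" "lf 6 2 = (\<not> lf 2 6)"
      "lf 5 2 = (\<not> lf 2 5)" "lf 5 1 = (\<not> lf 1 5)" "lf 4 1 = (\<not> lf 1 4)"
    using opp[of 0 4] opp[of 0 3] opp[of 3 6] opp[of 2 6] opp[of 2 5] opp[of 1 5] opp[of 1 4] by simp_all
  \<comment> \<open>Seven turns alternate with seven reversals. Since seven is odd, the chain leads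
    from \<open>lf 1 4\<close> to its own negation.\<close>
  ultimately show False by metis
qed

text \<open>If an interior point survives the deletion of one hull edge, the induction hypothesis
  forces \<open>k = 4\<close>; if it survives two deletions, it forces \<open>k = 5\<close>.
  Contradictions come from combining these values with each other or with the number of
  points.\<close>

theorem nonconvex_pm_catalan:
  assumes "finite S" "general_position S" "card S = 2 * k" "real (pm S) = catalan k"
    and "p \<in> S" "\<not> extremal S p"
  shows "k = 3 \<and> pentagon_type S"
  using assms
proof (induction k arbitrary: S p rule: less_induct)
  case (less k)
  note fin = less.prems(1) and gp = less.prems(2)
  obtain a b c where tri: "in_tri a b c p" "a \<in> S" "b \<in> S" "c \<in> S"
    using less.prems(6) unfolding extremal_def by blast
  then have "card {a, b, c, p} = 4" by (auto simp: in_tri_def card_insert_if)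
  then have "4 \<le> card S" using tri less.prems(5) card_mono[OF fin, of "{a, b, c, p}"] by auto
  then obtain n where k: "k = Suc n" "1 \<le> n" and card: "card S = 2 * Suc n" and card3: "3 \<le> card S"
    using less.prems(3) by (cases k) auto
  obtain h A where A: "hull_polygon S h A"
    using hull_polygon_exists[OF fin gp card3] by blast
  note poly = gp A
  define I where "I = S - range A"
  have ran: "range A \<subseteq> S" using polygon_range[OF poly] by blast
  have h3: "3 \<le> h" by (rule polygon_ge_3[OF poly])
  have p: "p \<in> I" using less.prems(5,6) polygon_range[OF poly] by (auto simp: I_def)
  have cardI: "h + card I = 2 * k"
    using polygon_card[OF poly] ran fin less.prems(3) card_mono[OF fin ran]
    by (simp add: I_def card_Diff_subset finite_subset)
  have notA: "A i \<noteq> x" if "x \<in> I" for i x using that by (auto simp: I_def)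
  let ?rem = "\<lambda>i. S - {A i, A (i + 1)}"
  have pm: "real (pm S) = catalan (Suc n)" using less.prems(4) k by simp
  note rem = pm_Diff_hull_edge[OF fin gp card polygon_edge[OF poly] pm]
  have remove1: "k = 4 \<and> pentagon_type (?rem i)" if "in_tri u v w x" "{u, v, w, x} \<subseteq> ?rem i" for i u v w x
  proof -
    have "n = 3 \<and> pentagon_type (?rem i)"
    proof (rule less.IH)
      show "\<not> extremal (?rem i) x" using not_extremal_in_tri that by blast
    qed (use k fin gp rem that general_position_Diff in auto)
    then show ?thesis using k by simp
  qed
  have remove2: "k = 5" if "in_tri u v w x" "{u, v, w, x} \<subseteq> ?rem i - {A j, A (j + 1)}"
    "{A j, A (j + 1)} \<subseteq> ?rem i" for i j u v w x
  proof -
    obtain m where m: "n = Suc m" using k by (cases n) auto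
    have e: "hull_edge (?rem i) (A j) (A (j + 1))"
      using hull_edge_subset[OF polygon_edge[OF poly, of j], of "?rem i"] that(3) by blast
    have "finite (?rem i)" "general_position (?rem i)" using fin gp general_position_Diff by auto
    note rem2 = pm_Diff_hull_edge[OF this _ e, of m] 
    have "m = 3 \<and> pentagon_type (?rem i - {A j, A (j + 1)})"
    proof (rule less.IH)
      show "\<not> extremal (?rem i - {A j, A (j + 1)}) x" using not_extremal_in_tri that by blast
    qed (use k m fin gp rem rem2 that general_position_Diff in auto)
    then show ?thesis using k m by simp
  qed
  have neq: "A a \<noteq> A b" "A b \<noteq> A a" if "a < b" "b < a + h" for a b
    using polygon_neq'[OF poly that] by auto
  have inS: "A i \<in> S" for i using ran by auto
  have vertex_in: "A j \<in> ?rem i" if "j < i \<and> i + 1 < j + h \<or> i + 1 < j \<and> j < i + h" for i j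
    using that
  proof (elim disjE conjE)
    assume "j < i" "i + 1 < j + h"
    then have "A j \<noteq> A i" "A j \<noteq> A (i + 1)" by (intro neq; simp)+
    then show ?thesis using inS by simp
  next
    assume "i + 1 < j" "j < i + h"
    then have "A j \<noteq> A i" "A j \<noteq> A (i + 1)" by (intro neq; simp)+
    then show ?thesis using inS by simp
  qed
  have interior_in: "x \<in> ?rem i" if "x \<in> I" for i x
  proof -
    have "x \<in> S" using that by (simp add: I_def)
    then show ?thesis using notA[OF that, of i] notA[OF that, of "i + 1"] by simp
  qed
  have vertex_in2: "A l \<in> ?rem i - {A j, A (j + 1)}"
    if "l < i \<and> i + 1 < l + h \<or> i + 1 < l \<and> l < i + h" "l < j \<and> j + 1 < l + h \<or> j + 1 < l \<and> l < j + h" for i j l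
    using vertex_in[OF that(1)] vertex_in[OF that(2)] by blast
  have interior_in2: "x \<in> ?rem i - {A j, A (j + 1)}" if "x \<in> I" for i j x
    using interior_in[OF that, of i] interior_in[OF that, of j] by blast
  \<comment> \<open>An exit edge is recorded by its first vertex, which determines it by
    \<open>polygon_next\<close>.\<close>
  define E where "E = (\<lambda>(x, y). SOME u. \<exists>i. u = A i \<and> in_tri (A i) (A (i + 1)) y x)"
  have E: "\<exists>i. E (x, y) = A i \<and> in_tri (A i) (A (i + 1)) y x" if xy: "x \<in> I" "y \<in> I" "x \<noteq> y" for x y
  proof -
    obtain i where "in_tri (A i) (A (i + 1)) y x"
      using polygon_exit[OF poly xy[unfolded I_def]] .
    then have "\<exists>u. \<exists>i. u = A i \<and> in_tri (A i) (A (i + 1)) y x" by blast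
    then show ?thesis unfolding E_def prod.case by (rule someI_ex)
  qed
  have E_range: "E (x, y) \<in> range A" if "x \<in> I" "y \<in> I" "x \<noteq> y" for x y
  proof -
    from E[OF that] obtain i where "E (x, y) = A i" by blast
    then show ?thesis by simp
  qed
  have finI: "finite I" using fin by (simp add: I_def)
  have finA: "finite (range A)" using ran fin finite_subset by blast
  have "0 < card I" using p finI card_gt_0_iff by blast
  then have "h = 3 \<or> 4 \<le> h \<and> 2 \<le> card I \<or> 4 \<le> h \<and> card I = 1" using h3 by linarith
  then consider "h = 3" | "4 \<le> h" "2 \<le> card I" | "4 \<le> h" "card I = 1" by blast
  then show ?case
  proof cases
    case 1
    \<comment> \<open>Two interior points leave the hull through the same edge as seen from \<open>p\<close>.\<close>
    have "A 3 = A 0" using polygon_period[OF poly, of 0] 1 by simp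
    then have "hull_edge S (A 2) (A 0)"
      using polygon_edge[OF poly, of 2] by simp
    moreover have "hull_edge S (A 1) (A 2)"
      using polygon_edge[OF poly, of 1] by (simp only: one_add_one)
    moreover have "hull_edge S (A 0) (A 1)"
      using polygon_edge[OF poly, of 0] by (simp only: add_0)
    ultimately have "3 * catalan n \<le> catalan k"
      using pm_triangular_hull[OF fin gp card] less.prems(4) by metis
    then have "\<not> k \<le> 4" using catalan_less_triple[of k] k by auto
    then have k5: "5 \<le> k" by simp
    \<comment> \<open>Here \<open>card I = 2 * k - 3\<close> is at least 7, so at least six points
      share three exit edges.\<close>
    have "card (I - {p}) > card (range A)"
      using cardI p finI k5 1 polygon_card[OF poly] by simp
    moreover have "(\<lambda>y. E (y, p)) ` (I - {p}) \<subseteq> range A"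
      using E_range[OF _ p] by blast
    ultimately have "\<not> inj_on (\<lambda>y. E (y, p)) (I - {p})"
      using card_inj_on_le[OF _ _ finA] by (metis leD)
    then obtain y z where yz: "y \<in> I" "z \<in> I" "y \<noteq> p" "z \<noteq> p" "y \<noteq> z" "E (y, p) = E (z, p)"
      by (auto simp: inj_on_def)
    obtain i where i: "E (y, p) = A i" "in_tri (A i) (A (i + 1)) p y" using E[OF yz(1) p yz(3)] by blast
    obtain j where j: "E (z, p) = A j" "in_tri (A j) (A (j + 1)) p z" using E[OF yz(2) p yz(4)] by blast
    have "A i = A j" using i j yz by simp
    then have "A (i + 1) = A (j + 1)" by (rule polygon_next[OF poly])
    then have tz: "in_tri (A i) (A (i + 1)) p z" using j \<open>A i = A j\<close> by simp
    have sub: "{A i, A (i + 1), p, y, z} \<subseteq> S" using inS yz p by (auto simp: I_def)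
    \<comment> \<open>Each triangle from \<open>two_points_in_triangle\<close> uses only one of
      \<open>A i\<close>, \<open>A (i + 1)\<close>; the hull edge joining the other to
      \<open>A (i + 2)\<close> can be deleted.\<close>
    have rem_i: "{p, A i, y, z} \<subseteq> ?rem (i + 1)"
      by (intro insert_subsetI vertex_in interior_in[OF p] interior_in[OF yz(1)] interior_in[OF yz(2)]
          empty_subsetI) (use 1 in arith)+
    have rem_i1: "{p, A (i + 1), y, z} \<subseteq> ?rem (i + 2)"
      by (intro insert_subsetI vertex_in interior_in[OF p] interior_in[OF yz(1)] interior_in[OF yz(2)]
          empty_subsetI) (use 1 in arith)+
    have "k = 4"
      using two_points_in_triangle[OF gp sub yz(5) i(2) tz]
    proof (elim disjE)
      assume "in_tri p (A i) z y"
      then show ?thesis using remove1[of p "A i" z y "i + 1"] rem_i by (simp add: insert_commute)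
    next
      assume "in_tri p y (A (i + 1)) z"
      then show ?thesis using remove1[of p y "A (i + 1)" z "i + 2"] rem_i1 by (simp add: insert_commute)
    next
      assume "in_tri p (A i) y z"
      then show ?thesis using remove1[of p "A i" y z "i + 1"] rem_i by (simp add: insert_commute)
    next
      assume "in_tri p z (A (i + 1)) y"
      then show ?thesis using remove1[of p z "A (i + 1)" y "i + 2"] rem_i1 by (simp add: insert_commute)
    qed
    then show ?thesis using k5 by simp
  next
    case 2
    have removable: "{A i, A (i + 1), y, x} \<subseteq> ?rem (i + 2)" if "x \<in> I" "y \<in> I" for i x y
      by (intro insert_subsetI vertex_in interior_in[OF that(1)] interior_in[OF that(2)] empty_subsetI)
        (use 2 in arith)+
    have pent: "k = 4 \<and> pentagon_type (?rem (i + 2))"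
      if "x \<in> I" "y \<in> I" "in_tri (A i) (A (i + 1)) y x" for i x y
      using remove1[OF that(3) removable[OF that(1,2)]] .
    obtain x where x: "x \<in> I" "x \<noteq> p"
    proof -
      have "\<not> I \<subseteq> {p}" using card_mono[of "{p}" I] 2 by auto
      then show thesis using that by blast
    qed
    obtain i where i: "in_tri (A i) (A (i + 1)) p x" using E[OF x(1) p x(2)] by blast
    have k4: "k = 4" using pent[OF x(1) p i] by simp
    \<comment> \<open>With six vertices, two disjoint edges avoid the exit edge, and deleting both
      would give \<open>k = 5\<close>.\<close>
    have "h < 6"
    proof (rule ccontr)
      assume "\<not> h < 6"
      then have h: "6 \<le> h" by simp
      have "k = 5"
      proof (rule remove2[OF i])
        show "{A i, A (i + 1), p, x} \<subseteq> ?rem (i + 2) - {A (i + 4), A (i + 4 + 1)}"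
          by (intro insert_subsetI vertex_in2 interior_in2[OF p] interior_in2[OF x(1)] empty_subsetI)
            (use h in arith)+
        show "{A (i + 4), A (i + 4 + 1)} \<subseteq> ?rem (i + 2)"
          by (intro insert_subsetI vertex_in empty_subsetI) (use h in arith)+
      qed
      then show False using k4 by simp
    qed
    \<comment> \<open>Each hull edge is the exit edge of at most one ordered pair of interior points.\<close>
    define D where "D = I \<times> I - (\<lambda>x. (x, x)) ` I"
    have "inj_on E D"
    proof (rule inj_onI, clarify)
      fix x y x' y' assume "(x, y) \<in> D" "(x', y') \<in> D" and eq: "E (x, y) = E (x', y')"
      then have I: "x \<in> I" "y \<in> I" "x \<noteq> y" "x' \<in> I" "y' \<in> I" "x' \<noteq> y'"
        by (auto simp: D_def)
      obtain i where i: "E (x, y) = A i" "in_tri (A i) (A (i + 1)) y x" using E[OF I(1-3)] by blast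
      obtain j where j: "E (x', y') = A j" "in_tri (A j) (A (j + 1)) y' x'" using E[OF I(4-6)] by blast
      have "A i = A j" using i j eq by simp
      then have "A (i + 1) = A (j + 1)" by (rule polygon_next[OF poly])
      then have t': "in_tri (A i) (A (i + 1)) y' x'" using j \<open>A i = A j\<close> by simp
      let ?T = "?rem (i + 2)"
      \<comment> \<open>The remaining six points have a single interior point, which forces
        \<open>x = x'\<close>; the edge has a single apex around it, which forces
        \<open>y = y'\<close>.\<close>
      have T: "pentagon_type ?T" using pent[OF I(1,2) i(2)] by simp
      note sub = removable[OF I(1,2), of i] removable[OF I(4,5), of i]
      have "x = x'"
        using pentagon_type_unique_interior[OF T, of x x'] not_extremal_in_tri[OF i(2), of ?T]
          not_extremal_in_tri[OF t', of ?T] sub by blast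
      have "general_position ?T" by (rule general_position_Diff[OF gp])
      moreover have "hull_edge ?T (A i) (A (i + 1))"
        using hull_edge_subset[OF polygon_edge[OF poly, of i], of ?T] sub by blast
      ultimately have "y = y'"
        using pentagon_type_unique_apex[of ?T "A i" "A (i + 1)" x y y'] T sub i(2) t' \<open>x = x'\<close> by blast
      show "x = x' \<and> y = y'" using \<open>x = x'\<close> \<open>y = y'\<close> by simp
    qed
    moreover have "E ` D \<subseteq> range A"
      using E_range by (auto simp: D_def)
    ultimately have "card D \<le> card (range A)"
      by (rule card_inj_on_le[OF _ _ finA])
    moreover have "card D = card I * card I - card I"
      unfolding D_def using finI by (subst card_Diff_subset) (auto simp: card_image inj_on_def)
    ultimately have "card I * card I - card I \<le> h" using polygon_card[OF poly] by simp
    \<comment> \<open>Since \<open>h + card I = 8\<close>, there would be 12 ordered pairs for 4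
      edges, or 6 for 5.\<close>
    moreover have "h = 4 \<and> card I = 4 \<or> h = 5 \<and> card I = 3" using 2 \<open>h < 6\<close> cardI k4 by linarith
    ultimately show ?thesis by auto
  next
    case 3
    then have I: "I = {p}" using p by (metis card_1_singletonE singletonD)
    then have S: "S = insert p (range A)" using ran p by (auto simp: I_def)
    have hk: "h + 1 = 2 * k" using cardI 3 by simp
    have pA: "p \<in> S - range A" using p by (simp add: I_def)
    \<comment> \<open>With one interior point, \<open>h = 2 * k - 1\<close> is odd.\<close>
    have "h = 5 \<or> 7 \<le> h" using hk 3(1) by presburger
    then consider "h = 5" | "7 \<le> h" by blast
    then show ?thesis
    proof cases
      case 1
      \<comment> \<open>Otherwise \<open>p\<close> lies in the corner triangle at
        \<open>A (i + 1)\<close> and survives deleting the edge of the other two vertices, giving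
        \<open>k = 4\<close> instead of 3.\<close>
      have "ccw (A i) (A (i + 2)) p" for i
      proof (rule ccontr)
        assume "\<not> ccw (A i) (A (i + 2)) p"
        then have "ccw (A (i + 2)) (A i) p"
          using polygon_side[OF poly pA, of i "i + 2"] neq[of i "i + 2"] 1 by auto
        then have "in_tri (A i) (A (i + 1)) (A (i + 2)) p"
          using polygon_interior[OF poly pA, of i] polygon_interior[OF poly pA, of "i + 1"]
          by (simp add: in_tri_def)
        moreover have "{A i, A (i + 1), A (i + 2), p} \<subseteq> ?rem (i + 3)"
          by (intro insert_subsetI vertex_in interior_in[OF p] empty_subsetI) (use 1 in arith)+
        ultimately have "k = 4" using remove1 by blast
        then show False using hk 1 by simp
      qed
      then have "pentagon_type S"
        unfolding pentagon_type_def using A pA S 1 by blast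
      then show ?thesis using hk 1 by simp
    next
      case 2
      obtain j where j: "0 < j" "j + 1 < h" "in_tri (A 0) (A (0 + j)) (A (0 + j + 1)) p"
        using polygon_fan[OF poly pA, of 0] by blast
      \<comment> \<open>Some edge avoids the fan triangle: \<open>A 4\<close>, \<open>A 5\<close> if
        its indices are at most 3, and \<open>A 1\<close>, \<open>A 2\<close> otherwise.\<close>
      have "k = 4"
      proof (cases "j < 3")
        case True
        then have "{A 0, A (0 + j), A (0 + j + 1), p} \<subseteq> ?rem 4"
          by (intro insert_subsetI vertex_in interior_in[OF p] empty_subsetI) (use 2 in arith)+
        then show ?thesis using remove1 j(3) by blast
      next
        case False
        then have "{A 0, A (0 + j), A (0 + j + 1), p} \<subseteq> ?rem 1"
          by (intro insert_subsetI vertex_in interior_in[OF p] empty_subsetI) (use 2 j in arith)+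
        then show ?thesis using remove1 j(3) by blast
      qed
      then have "hull_polygon S 7 A" using A hk by simp
      \<comment> \<open>The gaps beside the apex \<open>A (i + 4)\<close> hold two vertices each,
        that is, one deletable edge on either side.\<close>
      then obtain i where "in_tri (A i) (A (i + 1)) (A (i + 4)) p"
        using heptagon_triangle[OF gp _ pA] by blast
      moreover have "{A i, A (i + 1), A (i + 4), p} \<subseteq> ?rem (i + 2) - {A (i + 5), A (i + 5 + 1)}"
        by (intro insert_subsetI vertex_in2 interior_in2[OF p] empty_subsetI) (use 2 in arith)+
      moreover have "{A (i + 5), A (i + 5 + 1)} \<subseteq> ?rem (i + 2)"
        by (intro insert_subsetI vertex_in empty_subsetI) (use 2 in arith)+
      ultimately have "k = 5" by (rule remove2)
      then show ?thesis using \<open>k = 4\<close> by simp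
    qed
  qed
qed

section \<open>The order type of the exceptional configuration\<close>

text \<open>Sign conditions, stated without a surrounding set, that fix every orientation among the
  six points. They serve both \<open>S\<close> and the regular pentagon.\<close>

definition wheel :: "(nat \<Rightarrow> point) \<Rightarrow> point \<Rightarrow> bool" where
  "wheel A x \<longleftrightarrow> (\<forall>i. A (i + 5) = A i) \<and>
     (\<forall>i a b. 0 < a \<longrightarrow> a < b \<longrightarrow> b < 5 \<longrightarrow> ccw (A i) (A (i + a)) (A (i + b))) \<and>
     (\<forall>i. ccw (A i) (A (i + 1)) x \<and> ccw (A i) (A (i + 2)) x)"

lemma wheelD:
  assumes "wheel A x"
  shows "A (i + 5) = A i"
    "0 < a \<Longrightarrow> a < b \<Longrightarrow> b < 5 \<Longrightarrow> ccw (A i) (A (i + a)) (A (i + b))"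
    "ccw (A i) (A (i + 1)) x" "ccw (A i) (A (i + 2)) x"
  using assms unfolding wheel_def by simp_all

definition wheel_point :: "(nat \<Rightarrow> point) \<Rightarrow> point \<Rightarrow> nat \<Rightarrow> point" where
  "wheel_point A x i = (if i < 5 then A i else x)"

text \<open>For a triple containing the centre only the gap \<open>j - i\<close> matters. Gaps 1 and
  2 are given; gaps 3 and 4 are gaps 2 and 1 traversed backwards.\<close>

lemma wheel_orientation_sorted:
  assumes A: "wheel A x" and ijk: "i < j" "j < k" "k < 6"
  shows "orientation (wheel_point A x i) (wheel_point A x j) (wheel_point A x k) =
    (if k = 5 \<and> i + 2 < j then - 1 else 1)"
proof -
  have pos: "orientation a b c = 1" if "ccw a b c" for a b c
    using that by (simp add: orientation_det3 ccw_def)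
  have neg: "orientation a b c = - 1" if "ccw b a c" for a b c
  proof -
    have "det3 a b c = - det3 b a c" by (simp add: det3_def algebra_simps)
    then show ?thesis using that by (simp add: orientation_det3 ccw_def)
  qed
  show ?thesis
  proof (cases "k = 5")
    case False
    then have "0 < j - i" "j - i < k - i" "k - i < 5" using ijk by auto
    then have "ccw (A i) (A (i + (j - i))) (A (i + (k - i)))"
      by (rule wheelD(2)[OF A])
    then have "ccw (A i) (A j) (A k)" using ijk by simp
    then show ?thesis using False ijk pos by (simp add: wheel_point_def)
  next
    case True
    have "j - i = 1 \<or> j - i = 2 \<or> j - i = 3 \<or> j - i = 4" using ijk True by linarith
    then consider "j = i + 1" | "j = i + 2" | "i + 5 = j + 2" | "i + 5 = j + 1" using ijk by linarith
    then show ?thesis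
    proof cases
      case 1
      then have "ccw (A i) (A j) x" using wheelD(3,4)[OF A, of i] by simp
      then show ?thesis using 1 True ijk pos by (simp add: wheel_point_def)
    next
      case 2
      then have "ccw (A i) (A j) x" using wheelD(3,4)[OF A, of i] by simp
      then show ?thesis using 2 True ijk pos by (simp add: wheel_point_def)
    next
      case 3
      note wheelD(4)[OF A, of j] wheelD(1)[OF A, of i]
      then have "ccw (A j) (A i) x" using 3 by simp
      then show ?thesis using 3 True ijk neg by (simp add: wheel_point_def)
    next
      case 4
      note wheelD(3)[OF A, of j] wheelD(1)[OF A, of i]
      then have "ccw (A j) (A i) x" using 4 by simp
      then show ?thesis using 4 True ijk neg by (simp add: wheel_point_def)
    qed
  qed
qed

lemma orientation_rotate: "orientation b c a = orientation a b c"
  by (simp add: orientation_det3 det3_rotate)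

lemma orientation_swap: "orientation a c b = - orientation a b c"
  by (simp add: orientation_det3 det3_swap[of a b c] sgn_minus)

lemma orientation_degenerate:
  "a = b \<or> b = c \<or> a = c \<Longrightarrow> orientation a b c = 0"
  by (auto simp: orientation_det3 det3_def)

text \<open>Rotations and transpositions change both sides alike and generate all orders of a
  triple.\<close>

lemma orientation_eq_if_sorted_eq:
  fixes g t :: "nat \<Rightarrow> point"
  assumes sorted: "\<And>i j k. i < j \<Longrightarrow> j < k \<Longrightarrow> k < n \<Longrightarrow>
      orientation (g i) (g j) (g k) = orientation (t i) (t j) (t k)"
    and ijk: "i < n" "j < n" "k < n"
  shows "orientation (g i) (g j) (g k) = orientation (t i) (t j) (t k)"
proof -
  let ?eq = "\<lambda>i j k. orientation (g i) (g j) (g k) = orientation (t i) (t j) (t k)"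
  have rot: "?eq i j k \<Longrightarrow> ?eq j k i" for i j k by (simp only: orientation_rotate)
  have swap: "?eq i j k \<Longrightarrow> ?eq i k j" for i j k
    using orientation_swap[of "g i" "g k" "g j"] orientation_swap[of "t i" "t k" "t j"] by simp
  have "(i = j \<or> j = k \<or> i = k) \<or> i < j \<and> j < k \<or> i < k \<and> k < j \<or> j < i \<and> i < k
    \<or> j < k \<and> k < i \<or> k < i \<and> i < j \<or> k < j \<and> j < i" by linarith
  then consider "i = j \<or> j = k \<or> i = k" | "i < j" "j < k" | "i < k" "k < j" | "j < i" "i < k"
    | "j < k" "k < i" | "k < i" "i < j" | "k < j" "j < i" by blast
  then show ?thesis
  proof cases
    case 1
    then show ?thesis by (auto simp: orientation_degenerate)
  next
    case 2 then show ?thesis using sorted ijk by blast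
  next
    case 3 then show ?thesis using sorted[of i k j] ijk swap by blast
  next
    case 4 then show ?thesis using sorted[of j i k] ijk swap rot by blast
  next
    case 5 then show ?thesis using sorted[of j k i] ijk rot by blast
  next
    case 6 then show ?thesis using sorted[of k i j] ijk rot by blast
  next
    case 7 then show ?thesis using sorted[of k j i] ijk swap rot by blast
  qed
qed

text \<open>Two coinciding points together with a third index would give orientation 0, but sorted
  triples have orientation 1 or -1.\<close>

lemma wheel_point_inj:
  assumes "wheel A x"
  shows "inj_on (wheel_point A x) {..<6}"
proof -
  have "wheel_point A x i \<noteq> wheel_point A x j" if ij: "i < j" "j < 6" for i j
  proof
    assume eq: "wheel_point A x i = wheel_point A x j"
    obtain k where k: "k < 6" "k < i \<or> i < k \<and> k < j \<or> j < k"
    proof (cases "j = 5")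
      case True
      then show thesis using that[of 0] that[of 1] ij by (cases "i = 0") auto
    next
      case False
      then show thesis using that[of 5] ij by auto
    qed
    then consider "k < i" | "i < k" "k < j" | "j < k" by blast
    then show False
    proof cases
      case 1
      then show ?thesis
        using wheel_orientation_sorted[OF assms 1 ij] eq by (simp add: orientation_degenerate split: if_splits)
    next
      case 2
      then show ?thesis
        using wheel_orientation_sorted[OF assms 2 ij(2)] eq by (simp add: orientation_degenerate split: if_splits)
    next
      case 3
      then show ?thesis
        using wheel_orientation_sorted[OF assms ij(1) 3 k(1)] eq by (simp add: orientation_degenerate split: if_splits)
    qed
  qed
  then show ?thesis
    by (intro inj_onI) (metis lessThan_iff linorder_neqE_nat)
qed

lemma wheel_points: "wheel_point A x ` {..<6} = insert x (A ` {..<5})"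
proof -
  have "{..<6} = insert 5 {..<5::nat}" by auto
  then show ?thesis by (auto simp: wheel_point_def)
qed

lemma wheel_same_order_type:
  assumes A: "wheel A x" and B: "wheel B y"
  shows "same_order_type (insert x (A ` {..<5})) (insert y (B ` {..<5}))"
proof -
  let ?g = "wheel_point A x" and ?t = "wheel_point B y"
  define f where "f = ?t \<circ> inv_into {..<6} ?g"
  have bij: "bij_betw ?g {..<6} (?g ` {..<6})" "bij_betw ?t {..<6} (?t ` {..<6})"
    using wheel_point_inj A B by (auto intro: inj_on_imp_bij_betw)
  have "bij_betw f (?g ` {..<6}) (?t ` {..<6})"
    unfolding f_def by (rule bij_betw_trans[OF bij_betw_inv_into[OF bij(1)] bij(2)])
  moreover have fg: "f (?g i) = ?t i" if "i < 6" for i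
    using that wheel_point_inj[OF A] by (simp add: f_def inv_into_f_f)
  have "orientation (f a) (f b) (f c) = orientation a b c"
    if abc: "a \<in> ?g ` {..<6}" "b \<in> ?g ` {..<6}" "c \<in> ?g ` {..<6}" for a b c
  proof -
    obtain i j k where "i < 6" "j < 6" "k < 6" "a = ?g i" "b = ?g j" "c = ?g k"
      using abc by auto
    moreover have "orientation (?g i) (?g j) (?g k) = orientation (?t i) (?t j) (?t k)"
      by (rule orientation_eq_if_sorted_eq[of 6])
        (simp_all only: wheel_orientation_sorted[OF A] wheel_orientation_sorted[OF B] \<open>i < 6\<close> \<open>j < 6\<close> \<open>k < 6\<close>)
    ultimately show ?thesis by (simp add: fg)
  qed
  ultimately show ?thesis
    unfolding same_order_type_def wheel_points[symmetric] by blast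
qed

lemma pentagon_type_wheel:
  assumes "general_position S" "pentagon_type S"
  obtains A x where "wheel A x" "S = insert x (A ` {..<5})"
proof -
  obtain A x where A: "hull_polygon S 5 A" "x \<notin> range A" "S = insert x (range A)"
      and x: "\<And>i. ccw (A i) (A (i + 2)) x"
    using assms(2) unfolding pentagon_type_def by blast
  note poly = assms(1) A(1)
  have "range A = A ` {..<5}"
    using polygon_vertex[OF poly, of _ 0] by auto
  moreover have "wheel A x"
    unfolding wheel_def
  proof (intro conjI allI impI)
    show "ccw (A i) (A (i + 1)) x" for i
      using polygon_interior[OF poly, of x i] A(2,3) by simp
  qed (use polygon_period[OF poly] polygon_ccw[OF poly] x in simp_all)
  ultimately show thesis using that A(3) by simp
qed

section \<open>Orientations in the regular pentagon with its centre\<close>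

lemma sin_sum_of_arcs: "sin (2 * p) + sin (2 * q) - sin (2 * (p + q)) = 4 * sin p * sin q * sin (p + (q::real))"
proof -
  have "(2 * p + 2 * q) / 2 = p + q" "(2 * p - 2 * q) / 2 = p - q" by simp_all
  then have "sin (2 * p) + sin (2 * q) = 2 * sin (p + q) * cos (p - q)"
    using sin_plus_sin[of "2 * p" "2 * q"] by (simp only:)
  moreover have "sin (2 * (p + q)) = 2 * sin (p + q) * cos (p + q)"
    by (rule sin_double)
  moreover have "cos (p - q) = cos (p + q) + 2 * (sin p * sin q)"
    by (simp add: cos_add cos_diff)
  ultimately show ?thesis
    by (simp only:) (simp add: algebra_simps)
qed

lemma pentagon_vertex_nth:
  "pentagon_vertex j $ 1 = cos (2 * (pi * real j / 5))" "pentagon_vertex j $ 2 = sin (2 * (pi * real j / 5))"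
  by (simp_all add: pentagon_vertex_def mult.assoc)

lemma det3_pentagon_center: "det3 (pentagon_vertex i) (pentagon_vertex (i + a)) 0 = sin (2 * (pi * real a / 5))"
proof -
  have "2 * (pi * real a / 5) = 2 * (pi * real (i + a) / 5) - 2 * (pi * real i / 5)"
    by (simp add: field_simps)
  then have "sin (2 * (pi * real a / 5)) = sin (2 * (pi * real (i + a) / 5) - 2 * (pi * real i / 5))"
    by (rule arg_cong)
  then show ?thesis
    by (simp only: det3_def pentagon_vertex_nth sin_diff zero_index) (simp add: algebra_simps)
qed

lemma det3_origin: "det3 a b c = det3 a b 0 + det3 b c 0 - det3 a c 0"
  by (simp add: det3_def algebra_simps)

lemma sin_pentagon_pos: "0 < a \<Longrightarrow> a < 5 \<Longrightarrow> 0 < sin (pi * real a / 5)"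
  by (rule sin_gt_zero) (simp_all add: field_simps)

text \<open>Splitting an inscribed triangle at the centre expresses its determinant by sines of
  arcs. \<open>sin_sum_of_arcs\<close> rewrites this as four times the product of the sines of the
  half arcs, which are positive.\<close>

lemma wheel_pentagon: "wheel pentagon_vertex 0"
  unfolding wheel_def
proof (intro conjI allI impI)
  fix i
  have "2 * (pi * real (i + 5) / 5) = 2 * (pi * real i / 5) + 2 * pi"
    by (simp add: field_simps)
  then show "pentagon_vertex (i + 5) = pentagon_vertex i"
    by (simp only: vec_eq_iff forall_2 pentagon_vertex_nth sin_periodic cos_periodic)
  have "0 < sin (2 * (pi * real 1 / 5))" "0 < sin (2 * (pi * real 2 / 5))"
    using sin_pentagon_pos[of 2] sin_pentagon_pos[of 4] by (simp_all add: mult.commute)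
  then show "ccw (pentagon_vertex i) (pentagon_vertex (i + 1)) 0"
      "ccw (pentagon_vertex i) (pentagon_vertex (i + 2)) 0"
    unfolding ccw_def det3_pentagon_center by simp_all
next
  fix i a b :: nat
  assume ab: "0 < a" "a < b" "b < 5"
  define c where "c = b - a"
  have b: "b = a + c" and c: "0 < c" "c < 5" using ab by (auto simp: c_def)
  have "det3 (pentagon_vertex i) (pentagon_vertex (i + a)) (pentagon_vertex (i + b)) =
      sin (2 * (pi * real a / 5)) + sin (2 * (pi * real c / 5)) - sin (2 * (pi * real b / 5))"
    using det3_pentagon_center[of i a] det3_pentagon_center[of "i + a" c] det3_pentagon_center[of i b]
    by (subst det3_origin) (simp add: b add.assoc)
  also have "\<dots> = 4 * sin (pi * real a / 5) * sin (pi * real c / 5) * sin (pi * real b / 5)"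
    using sin_sum_of_arcs[of "pi * real a / 5" "pi * real c / 5"]
    by (simp add: b distrib_left add_divide_distrib)
  also have "\<dots> > 0"
    using sin_pentagon_pos[of a] sin_pentagon_pos[of b] sin_pentagon_pos[of c] ab c by simp
  finally show "ccw (pentagon_vertex i) (pentagon_vertex (i + a)) (pentagon_vertex (i + b))"
    by (simp add: ccw_def)
qed

theorem theorem3:
  fixes k :: nat and S :: "(real ^ 2) set"
  assumes "finite S"
    and "card S = 2 * k"
    and "general_position S"
    and "real (pm S) = catalan k"
  shows "convex_position S \<or> (k = 3 \<and> same_order_type S pentagon_with_center)"
proof (cases "\<forall>p\<in>S. extremal S p")
  case True
  then show ?thesis using convex_position_if_extremal assms by blast
next
  case False
  then have k: "k = 3" and S: "pentagon_type S"
    using nonconvex_pm_catalan[OF assms(1,3,2,4)] by blast+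
  obtain A x where "wheel A x" "S = insert x (A ` {..<5})"
    using pentagon_type_wheel[OF assms(3) S] .
  then show ?thesis
    using k wheel_same_order_type[OF _ wheel_pentagon] by (simp add: pentagon_with_center_def)
qed

end
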